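(* Let $d\ge2$ and $M\ge1$ be integers, let $x_1,\dots,x_M\in\mathbb{S}^{d-1}$ be pairwise distinct, $\Omega=\{x_1,\dots,x_M\}$, let $\hat f_1,\dots,\hat f_M\in\mathbb{R}\setminus\{0\}$, and let $$f\colon\{(k,\ell):k\in\mathbb{N}_0,\ \ell=1,\dots,N_k\}\to\mathbb{R},\quad f(k,\ell)=\sum_{j=1}^M\hat f_j\,Y_k^\ell(x_j),$$ be the corresponding $M$-sparse spherical harmonic sum. Let $q>0$ and suppose the parameters are $q$-separated, i.e. $\operatorname{sep}(\Omega)>q$. If $n\in\mathbb{N}_0$ satisfies $n>2.5\pi d/q+1$, then $$\Omega=\mathcal{V}_{\mathbb{S}^{d-1}}(\ker\tilde H_n),$$ where $$\tilde H_n:=Y_n^\top D\,Y_n\in\mathbb{R}^{N\times N},\qquad D=\operatorname{diag}(\hat f_1,\dots,\hat f_M).$$ Moreover, the entries of $\tilde H_n$ can be computed solely from the moments $f(k,\ell)$, $k\le 2n$, $\ell=1,\dots,N_k$ (that is, they are given by a function of these moments that depends only on $d$, $n$ and the chosen basis of spherical harmonics, not on $M$, the $\hat f_j$ or the $x_j$).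
   Context: $\mathbb{S}^{d-1}=\{x\in\mathbb{R}^d:x^\top x=1\}$. For $k\in\mathbb{N}_0$, $H_k^d$ is the space of real spherical harmonics of degree $k$ on $\mathbb{S}^{d-1}$ (restrictions to the sphere of real homogeneous harmonic polynomials of degree $k$ in $d$ variables), $N_k=\dim H_k^d$, and $\{Y_k^\ell:\ell=1,\dots,N_k\}$ is a fixed basis of $H_k^d$ of real-valued functions, orthonormal in $L^2(\mathbb{S}^{d-1})$ with respect to the surface measure. The spaces $H_k^d$, $k=0,\dots,n$, are mutually orthogonal and their direct sum is the space of restrictions to $\mathbb{S}^{d-1}$ of real polynomials in $d$ variables of total degree at most $n$; $N=\sum_{k=0}^nN_k$ is its dimension. The nonequispaced spherical Fourier matrix is $Y_n=(Y_k^\ell(x_j))\in\mathbb{R}^{M\times N}$, with rows indexed by $j=1,\dots,M$ and columns by $(k,\ell)$, $0\le k\le n$, $1\le\ell\le N_k$. The separation distance is $\operatorname{sep}(\Omega)=\min_{j\ne\ell}\arccos(x_j^\top x_\ell)$ (for $M=1$ there is no pair $j\neq\ell$ and the separation condition is regarded as satisfied). A vector $(p_k^\ell)\in\mathbb{R}^N$ is identified with the function $\sum_{k=0}^n\sum_{\ell=1}^{N_k}p_k^\ell Y_k^\ell$ on $\mathbb{S}^{d-1}$, and for a set $Q$ of such functions, $\mathcal{V}_{\mathbb{S}^{d-1}}(Q)=\{a\in\mathbb{S}^{d-1}:g(a)=0\text{ for all }g\in Q\}$. *)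

theory Defs
  imports "HOL-Analysis.Analysis" "HOL-Library.Function_Algebras"
begin

section \<open>Spherical harmonics\<close>

global_interpretation fun_vs: vector_space "\<lambda>(c::real) (f::'a \<Rightarrow> real) x. c * f x"
  by unfold_locales (auto simp: fun_eq_iff algebra_simps)

definition monomial :: "('d::finite \<Rightarrow> nat) \<Rightarrow> real ^ 'd \<Rightarrow> real" where
  "monomial \<alpha> = (\<lambda>x. \<Prod>i\<in>UNIV. x $ i ^ \<alpha> i)"

definition homogeneous_polys :: "nat \<Rightarrow> (real ^ 'd::finite \<Rightarrow> real) set" where
  "homogeneous_polys k = fun_vs.span (monomial ` {\<alpha>. sum \<alpha> UNIV = k})"

definition partial_deriv :: "'d::finite \<Rightarrow> (real ^ 'd \<Rightarrow> real) \<Rightarrow> real ^ 'd \<Rightarrow> real" where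
  "partial_deriv i f = (\<lambda>x. deriv (\<lambda>t. f (x + t *\<^sub>R axis i 1)) 0)"

definition laplacian :: "(real ^ 'd::finite \<Rightarrow> real) \<Rightarrow> real ^ 'd \<Rightarrow> real" where
  "laplacian f = (\<lambda>x. \<Sum>i\<in>UNIV. partial_deriv i (partial_deriv i f) x)"

text \<open>
  A function on the unit sphere is represented by its extension by zero to the whole space.
  This makes equality of functions on the sphere plain equality, and the functions on the sphere a
  linear subspace of all functions.
\<close>

definition sphere_restrict :: "(real ^ 'd::finite \<Rightarrow> real) \<Rightarrow> real ^ 'd \<Rightarrow> real" where
  "sphere_restrict p = (\<lambda>x. if x \<in> sphere 0 1 then p x else 0)"

definition spherical_harmonics :: "nat \<Rightarrow> (real ^ 'd::finite \<Rightarrow> real) set" where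
  "spherical_harmonics k = sphere_restrict ` {p \<in> homogeneous_polys k. \<forall>x. laplacian p x = 0}"

text \<open>The dimension of the ambient space is the cardinality of the index type \<open>'d\<close>.\<close>

definition harm_dim :: "'d::finite itself \<Rightarrow> nat \<Rightarrow> nat" where
  "harm_dim _ k = fun_vs.dim (spherical_harmonics k :: (real ^ 'd \<Rightarrow> real) set)"

text \<open>
  The surface measure of a Borel subset \<open>A\<close> of the unit sphere is \<open>CARD('d)\<close> times the Lebesgue
  measure of the cone \<open>{t *\<^sub>R a | t a. 0 < t \<and> t \<le> 1 \<and> a \<in> A}\<close> (polar coordinates).
  Note that \<open>sgn x = x /\<^sub>R norm x\<close>.
\<close>

definition surface_measure :: "(real ^ 'd::finite) measure" where
  "surface_measure = scale_measure (of_nat CARD('d))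
     (distr (restrict_space lborel (cball 0 1 - {0})) (restrict_space borel (sphere 0 1)) sgn)"

definition sphere_inner :: "(real ^ 'd::finite \<Rightarrow> real) \<Rightarrow> (real ^ 'd \<Rightarrow> real) \<Rightarrow> real" where
  "sphere_inner f g = (LINT x|surface_measure. f x * g x)"

text \<open>\<open>Y k l\<close>, \<open>1 \<le> l \<le> N\<^sub>k\<close>, is an orthonormal basis of the spherical harmonics of degree \<open>k\<close>;
  linear independence follows from orthonormality.\<close>

definition orthonormal_harmonic_basis :: "(nat \<Rightarrow> nat \<Rightarrow> real ^ 'd::finite \<Rightarrow> real) \<Rightarrow> bool" where
  "orthonormal_harmonic_basis Y \<longleftrightarrow>
     (\<forall>k. (\<forall>l\<in>{1..harm_dim TYPE('d) k}. \<forall>m\<in>{1..harm_dim TYPE('d) k}.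
             sphere_inner (Y k l) (Y k m) = (if l = m then 1 else 0)) \<and>
          fun_vs.span (Y k ` {1..harm_dim TYPE('d) k}) = spherical_harmonics k)"

definition harm_index :: "'d::finite itself \<Rightarrow> nat \<Rightarrow> (nat \<times> nat) set" where
  "harm_index d n = (SIGMA k:{..n}. {1..harm_dim d k})"

section \<open>Matrices indexed by finite sets\<close>

text \<open>
  An \<open>I \<times> J\<close> matrix is a function of a row and a column index, of which only the values on
  \<open>I \<times> J\<close> matter.  Vectors indexed by \<open>J\<close> are extensional functions.
\<close>

definition mat_mult :: "'j set \<Rightarrow> ('i \<Rightarrow> 'j \<Rightarrow> real) \<Rightarrow> ('j \<Rightarrow> 'k \<Rightarrow> real) \<Rightarrow> 'i \<Rightarrow> 'k \<Rightarrow> real" where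
  "mat_mult J A B = (\<lambda>i k. \<Sum>j\<in>J. A i j * B j k)"

definition mat_transpose :: "('i \<Rightarrow> 'j \<Rightarrow> real) \<Rightarrow> 'j \<Rightarrow> 'i \<Rightarrow> real" where
  "mat_transpose A = (\<lambda>j i. A i j)"

definition mat_diag :: "('i \<Rightarrow> real) \<Rightarrow> 'i \<Rightarrow> 'i \<Rightarrow> real" where
  "mat_diag a = (\<lambda>i j. if i = j then a i else 0)"

definition mat_ker :: "'i set \<Rightarrow> 'j set \<Rightarrow> ('i \<Rightarrow> 'j \<Rightarrow> real) \<Rightarrow> ('j \<Rightarrow> real) set" where
  "mat_ker I J A = {p \<in> J \<rightarrow>\<^sub>E UNIV. \<forall>i\<in>I. (\<Sum>j\<in>J. A i j * p j) = 0}"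

section \<open>Sparse spherical harmonic sums\<close>

definition moments ::
  "(nat \<Rightarrow> nat \<Rightarrow> real ^ 'd::finite \<Rightarrow> real) \<Rightarrow> nat \<Rightarrow> (nat \<Rightarrow> real) \<Rightarrow> (nat \<Rightarrow> real ^ 'd) \<Rightarrow>
   nat \<times> nat \<Rightarrow> real" where
  "moments Y M fh x = (\<lambda>(k, l). \<Sum>j=1..M. fh j * Y k l (x j))"

definition fourier_matrix ::
  "(nat \<Rightarrow> nat \<Rightarrow> real ^ 'd::finite \<Rightarrow> real) \<Rightarrow> (nat \<Rightarrow> real ^ 'd) \<Rightarrow> nat \<Rightarrow> nat \<times> nat \<Rightarrow> real" where
  "fourier_matrix Y x = (\<lambda>j (k, l). Y k l (x j))"

definition H_tilde ::
  "(nat \<Rightarrow> nat \<Rightarrow> real ^ 'd::finite \<Rightarrow> real) \<Rightarrow> nat \<Rightarrow> (nat \<Rightarrow> real) \<Rightarrow> (nat \<Rightarrow> real ^ 'd) \<Rightarrow>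
   nat \<times> nat \<Rightarrow> nat \<times> nat \<Rightarrow> real" where
  "H_tilde Y M fh x =
     mat_mult {1..M} (mat_mult {1..M} (mat_transpose (fourier_matrix Y x)) (mat_diag fh))
       (fourier_matrix Y x)"

text \<open>Only meaningful for sets of at least two points: for fewer, this is \<open>Min {}\<close>, which is unspecified.\<close>

definition sep :: "(real ^ 'd::finite) set \<Rightarrow> real" where
  "sep \<Omega> = Min {arccos (a \<bullet> b) | a b. a \<in> \<Omega> \<and> b \<in> \<Omega> \<and> a \<noteq> b}"

definition fun_of_coeffs ::
  "(nat \<Rightarrow> nat \<Rightarrow> real ^ 'd::finite \<Rightarrow> real) \<Rightarrow> nat \<Rightarrow> (nat \<times> nat \<Rightarrow> real) \<Rightarrow> real ^ 'd \<Rightarrow> real" where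
  "fun_of_coeffs Y n p = (\<lambda>a. \<Sum>(k, l)\<in>harm_index TYPE('d) n. p (k, l) * Y k l a)"

definition sphere_zeros :: "(real ^ 'd::finite \<Rightarrow> real) set \<Rightarrow> (real ^ 'd) set" where
  "sphere_zeros Q = {a \<in> sphere 0 1. \<forall>g\<in>Q. g a = 0}"

end

theory Submission
  imports Defs
begin

text \<open>
  Every homogeneous polynomial differs from a harmonic one by a multiple of \<open>|x|\<^sup>2\<close>, so on the sphere
  the spherical harmonics of degree at most \<open>n\<close> span all polynomials of degree at most \<open>n\<close>.  Put
  \<open>m = n - 1\<close>, \<open>d = CARD('d)\<close> and let \<open>N - 1\<close> be the integer part of \<open>m / d\<close>.  The \<open>d\<close>-th power of the
  Fejer kernel of degree \<open>N - 1\<close> in \<open>x \<bullet> y\<close> decays like \<open>dist x y\<close> to the power \<open>- 2 * d\<close>, while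
  volume comparison bounds the number of points of \<open>\<Omega>\<close> in a ball of radius \<open>R\<close> by a multiple of
  \<open>R ^ d\<close>; the condition on \<open>n\<close> makes the resulting kernel matrix strictly diagonally dominant.
  Hence point evaluations at \<open>\<Omega>\<close> are linearly independent on polynomials of degree \<open>m\<close>.  It follows
  that the kernel of \<open>H_tilde\<close> consists of the polynomials vanishing on \<open>\<Omega>\<close>, and Lagrange
  polynomials of degree \<open>m\<close> times linear functions cut out exactly \<open>\<Omega>\<close>.
\<close>

section \<open>Spaces of polynomial functions\<close>

lemma fun_span_add:
  "f \<in> fun_vs.span S \<Longrightarrow> g \<in> fun_vs.span S \<Longrightarrow> (\<lambda>x. f x + g x) \<in> fun_vs.span S"
  using fun_vs.span_add[of f S g] by (simp add: plus_fun_def)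

lemma fun_span_diff:
  "f \<in> fun_vs.span S \<Longrightarrow> g \<in> fun_vs.span S \<Longrightarrow> (\<lambda>x. f x - g x) \<in> fun_vs.span S"
  using fun_vs.span_diff[of f S g] by (simp add: fun_diff_def)

lemma fun_span_zero: "(\<lambda>x. 0) \<in> fun_vs.span S"
  using fun_vs.span_zero[of S] by (simp add: zero_fun_def)

lemma fun_span_sum:
  "(\<And>i. i \<in> I \<Longrightarrow> f i \<in> fun_vs.span S) \<Longrightarrow> (\<lambda>x. \<Sum>i\<in>I. f i x) \<in> fun_vs.span S"
  by (induction I rule: infinite_finite_induct) (auto intro: fun_span_add fun_span_zero)

lemma fun_span_induct [consumes 1, case_names base zero add scale]:
  assumes "f \<in> fun_vs.span S"
    and "\<And>f. f \<in> S \<Longrightarrow> P f" and "P (\<lambda>x. 0)"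
    and "\<And>f g. P f \<Longrightarrow> P g \<Longrightarrow> P (\<lambda>x. f x + g x)"
    and "\<And>c f. P f \<Longrightarrow> P (\<lambda>x. c * f x)"
  shows "P f"
proof -
  have "fun_vs.span S \<subseteq> Collect P"
    using assms(2-)
    by (intro fun_vs.span_minimal) (auto simp: fun_vs.subspace_def zero_fun_def plus_fun_def)
  with assms(1) show ?thesis by blast
qed

text \<open>Bilinearity: for a generator \<open>f\<close> the claim is linear in \<open>g\<close>,
  and for fixed \<open>g\<close> it is then linear in \<open>f\<close>.\<close>

lemma fun_span_mult:
  assumes "f \<in> fun_vs.span A" "g \<in> fun_vs.span B"
    and AB: "\<And>f g. f \<in> A \<Longrightarrow> g \<in> B \<Longrightarrow> (\<lambda>x. f x * g x) \<in> fun_vs.span C"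
  shows "(\<lambda>x. f x * g x) \<in> fun_vs.span C"
  using assms(1)
proof (induction rule: fun_span_induct)
  case (base f)
  from assms(2) show ?case
  proof (induction rule: fun_span_induct)
    case (base g)
    then show ?case using AB \<open>f \<in> A\<close> by blast
  next
    case (scale c g)
    then show ?case using fun_vs.span_scale[of "\<lambda>x. f x * g x" C c] by (simp add: mult.left_commute)
  qed (auto simp: distrib_left intro: fun_span_add fun_span_zero)
next
  case (scale c f)
  then show ?case using fun_vs.span_scale[of "\<lambda>x. f x * g x" C c] by (simp add: mult.assoc)
qed (auto simp: distrib_right intro: fun_span_add fun_span_zero)

text \<open>Linearity of \<open>L\<close> is stated pointwise, in the shape of the equations for
  \<open>sphere_restrict\<close>, to which the lemma is applied.\<close>

lemma fun_span_image:
  assumes "f \<in> fun_vs.span S"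
    and "\<And>f. f \<in> S \<Longrightarrow> L f \<in> fun_vs.span T" and "L (\<lambda>x. 0) = (\<lambda>x. 0)"
    and "\<And>f g. L (\<lambda>x. f x + g x) = (\<lambda>x. L f x + L g x)"
    and "\<And>c f. L (\<lambda>x. c * f x) = (\<lambda>x. c * L f x)"
  shows "L f \<in> fun_vs.span T"
  using assms(1)
  by (induction rule: fun_span_induct)
    (use assms(2-) in \<open>auto intro: fun_span_add fun_span_zero fun_vs.span_scale\<close>)

section \<open>Polynomial functions of bounded total degree\<close>

text \<open>These are functions on the whole space, so that degrees add under pointwise products;
  the restriction to the sphere comes in only with the harmonic expansion.\<close>

definition poly_funs :: "nat \<Rightarrow> (real ^ 'd::finite \<Rightarrow> real) set" where
  "poly_funs n = fun_vs.span (monomial ` {\<alpha>. sum \<alpha> UNIV \<le> n})"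

lemma monomial_mult: "monomial \<alpha> x * monomial \<beta> x = monomial (\<lambda>i. \<alpha> i + \<beta> i) x"
  by (simp add: monomial_def power_add prod.distrib)

lemma monomial_in_homogeneous: "sum \<alpha> UNIV = k \<Longrightarrow> monomial \<alpha> \<in> homogeneous_polys k"
  unfolding homogeneous_polys_def by (intro fun_vs.span_base) auto

lemma homogeneous_mult:
  assumes "f \<in> homogeneous_polys a" "g \<in> homogeneous_polys b"
  shows "(\<lambda>x. f x * g x) \<in> homogeneous_polys (a + b)"
  using assms unfolding homogeneous_polys_def
proof (rule fun_span_mult)
  fix f g :: "real ^ 'a \<Rightarrow> real"
  assume "f \<in> monomial ` {\<alpha>. sum \<alpha> UNIV = a}" "g \<in> monomial ` {\<alpha>. sum \<alpha> UNIV = b}"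
  then show "(\<lambda>x. f x * g x) \<in> fun_vs.span (monomial ` {\<alpha>. sum \<alpha> UNIV = a + b})"
    by (auto simp: monomial_mult sum.distrib intro!: fun_vs.span_base)
qed

lemma poly_funs_mult:
  assumes "f \<in> poly_funs a" "g \<in> poly_funs b"
  shows "(\<lambda>x. f x * g x) \<in> poly_funs (a + b)"
  using assms unfolding poly_funs_def
proof (rule fun_span_mult)
  fix f g :: "real ^ 'a \<Rightarrow> real"
  assume "f \<in> monomial ` {\<alpha>. sum \<alpha> UNIV \<le> a}" "g \<in> monomial ` {\<alpha>. sum \<alpha> UNIV \<le> b}"
  then show "(\<lambda>x. f x * g x) \<in> fun_vs.span (monomial ` {\<alpha>. sum \<alpha> UNIV \<le> a + b})"
    by (auto simp: monomial_mult sum.distrib intro!: fun_vs.span_base)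
qed

lemma poly_funs_mono: "m \<le> n \<Longrightarrow> poly_funs m \<subseteq> poly_funs n"
  unfolding poly_funs_def by (intro fun_vs.span_mono) auto

lemma homogeneous_subset_poly_funs: "homogeneous_polys n \<subseteq> poly_funs n"
  unfolding poly_funs_def homogeneous_polys_def by (intro fun_vs.span_mono) auto

lemma homogeneous_const: "(\<lambda>x. c) \<in> homogeneous_polys 0"
proof -
  have "monomial (\<lambda>_. 0) \<in> homogeneous_polys 0"
    by (intro monomial_in_homogeneous) auto
  then have "(\<lambda>x. c * monomial (\<lambda>_. 0) x) \<in> homogeneous_polys 0"
    unfolding homogeneous_polys_def by (rule fun_vs.span_scale)
  then show ?thesis by (simp add: monomial_def)
qed

lemma poly_funs_const: "(\<lambda>x. c) \<in> poly_funs n"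
  using homogeneous_const homogeneous_subset_poly_funs poly_funs_mono[of 0 n] by blast

lemma homogeneous_component: "(\<lambda>x. x $ i) \<in> homogeneous_polys 1"
proof -
  have "monomial (\<lambda>j. if j = i then 1 else 0) \<in> homogeneous_polys 1"
    by (intro monomial_in_homogeneous) simp
  also have "monomial (\<lambda>j. if j = i then 1 else 0) = (\<lambda>x. x $ i)"
    by (auto simp: monomial_def fun_eq_iff if_distrib cong: if_cong)
  finally show ?thesis .
qed

lemma homogeneous_norm2: "(\<lambda>x. x \<bullet> x) \<in> homogeneous_polys 2"
proof -
  have "(\<lambda>x::real^'a. x $ i * x $ i) \<in> homogeneous_polys 2" for i
    using homogeneous_mult[OF homogeneous_component homogeneous_component, of i i]
    by (simp add: numeral_2_eq_2)
  then have "(\<lambda>x::real^'a. \<Sum>i\<in>UNIV. x $ i * x $ i) \<in> homogeneous_polys 2"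
    unfolding homogeneous_polys_def by (intro fun_span_sum)
  then show ?thesis by (simp add: inner_vec_def)
qed

lemma poly_funs_inner: "(\<lambda>x. a \<bullet> x) \<in> poly_funs 1"
proof -
  have "(\<lambda>x::real^'a. \<Sum>i\<in>UNIV. a $ i * x $ i) \<in> homogeneous_polys 1"
    using homogeneous_component unfolding homogeneous_polys_def
    by (intro fun_span_sum fun_vs.span_scale) auto
  then show ?thesis using homogeneous_subset_poly_funs by (auto simp: inner_vec_def)
qed

lemma poly_funs_add: "f \<in> poly_funs n \<Longrightarrow> g \<in> poly_funs n \<Longrightarrow> (\<lambda>x. f x + g x) \<in> poly_funs n"
  unfolding poly_funs_def by (rule fun_span_add)

lemma poly_funs_diff: "f \<in> poly_funs n \<Longrightarrow> g \<in> poly_funs n \<Longrightarrow> (\<lambda>x. f x - g x) \<in> poly_funs n"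
  unfolding poly_funs_def by (rule fun_span_diff)

lemma poly_funs_scale: "f \<in> poly_funs n \<Longrightarrow> (\<lambda>x. c * f x) \<in> poly_funs n"
  unfolding poly_funs_def by (rule fun_vs.span_scale)

lemma poly_funs_sum: "(\<And>i. i \<in> I \<Longrightarrow> f i \<in> poly_funs n) \<Longrightarrow> (\<lambda>x. \<Sum>i\<in>I. f i x) \<in> poly_funs n"
  unfolding poly_funs_def by (rule fun_span_sum)

lemma poly_funs_power: "f \<in> poly_funs n \<Longrightarrow> (\<lambda>x. f x ^ k) \<in> poly_funs (k * n)"
  by (induction k) (auto intro: poly_funs_const poly_funs_mult)

section \<open>Differentiation of homogeneous polynomials\<close>

text \<open>All factors but the one of index \<open>i\<close> are constant along
  \<open>axis i 1\<close>. For \<open>\<alpha> i = 0\<close> the truncated exponent does no harm,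
  since the factor \<open>real (\<alpha> i)\<close> vanishes.\<close>

lemma has_partial_deriv_monomial:
  "((\<lambda>t. monomial \<alpha> (x + t *\<^sub>R axis i 1)) has_field_derivative
     real (\<alpha> i) * monomial (\<alpha>(i := \<alpha> i - 1)) x) (at 0)"
proof -
  define C where "C = (\<Prod>j\<in>UNIV - {i}. x $ j ^ \<alpha> j)"
  have "monomial \<alpha> (x + t *\<^sub>R axis i 1) = (x $ i + t) ^ \<alpha> i * C" for t
    unfolding monomial_def C_def
    by (subst prod.remove[of _ i]) (auto simp: axis_def intro!: prod.cong)
  moreover have "monomial (\<alpha>(i := \<alpha> i - 1)) x = x $ i ^ (\<alpha> i - 1) * C"
    unfolding monomial_def C_def
    by (subst prod.remove[of _ i]) (auto intro!: prod.cong)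
  moreover have "((\<lambda>t. (x $ i + t) ^ \<alpha> i * C) has_field_derivative
      real (\<alpha> i) * (x $ i ^ (\<alpha> i - 1) * C)) (at 0)"
    by (auto intro!: derivative_eq_intros)
  ultimately show ?thesis by simp
qed

lemma partial_deriv_monomial:
  "partial_deriv i (monomial \<alpha>) = (\<lambda>x. real (\<alpha> i) * monomial (\<alpha>(i := \<alpha> i - 1)) x)"
  unfolding partial_deriv_def using has_partial_deriv_monomial by (intro ext DERIV_imp_deriv)

text \<open>\<open>deriv\<close> is an arbitrary value where no derivative exists. This predicate
  says that \<open>partial_deriv\<close> is a genuine derivative everywhere, which the sum and
  product rules require.\<close>

definition partially_differentiable :: "(real ^ 'd::finite \<Rightarrow> real) \<Rightarrow> bool" where
  "partially_differentiable f \<longleftrightarrow>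
     (\<forall>i x. ((\<lambda>t. f (x + t *\<^sub>R axis i 1)) has_field_derivative partial_deriv i f x) (at 0))"

lemma partially_differentiableI:
  assumes "\<And>i x. ((\<lambda>t. f (x + t *\<^sub>R axis i 1)) has_field_derivative f' i x) (at 0)"
  shows "partially_differentiable f" and "partial_deriv i f = f' i"
proof -
  have "partial_deriv i f = f' i" for i
    unfolding partial_deriv_def using assms by (intro ext DERIV_imp_deriv)
  then show "partially_differentiable f" "partial_deriv i f = f' i"
    using assms by (auto simp: partially_differentiable_def)
qed

lemma partially_differentiableD:
  "partially_differentiable f \<Longrightarrow>
    ((\<lambda>t. f (x + t *\<^sub>R axis i 1)) has_field_derivative partial_deriv i f x) (at 0)"
  by (auto simp: partially_differentiable_def)

lemma partial_deriv_const:
  "partially_differentiable (\<lambda>x. c)" "partial_deriv i (\<lambda>x. c) = (\<lambda>x. 0)"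
  by (rule partially_differentiableI[where f' = "\<lambda>_ _. 0"], simp)+

lemma partial_deriv_add:
  assumes "partially_differentiable f" "partially_differentiable g"
  shows "partially_differentiable (\<lambda>x. f x + g x)"
    and "partial_deriv i (\<lambda>x. f x + g x) = (\<lambda>x. partial_deriv i f x + partial_deriv i g x)"
  by (rule partially_differentiableI[where f' = "\<lambda>i x. partial_deriv i f x + partial_deriv i g x"],
      intro DERIV_add partially_differentiableD assms)+

lemma partial_deriv_mult:
  assumes "partially_differentiable f" "partially_differentiable g"
  shows "partially_differentiable (\<lambda>x. f x * g x)"
    and "partial_deriv i (\<lambda>x. f x * g x) = (\<lambda>x. partial_deriv i f x * g x + f x * partial_deriv i g x)"
proof -
  have "((\<lambda>t. f (x + t *\<^sub>R axis i 1) * g (x + t *\<^sub>R axis i 1)) has_field_derivative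
      partial_deriv i f x * g x + f x * partial_deriv i g x) (at 0)" for i x
    using DERIV_mult[OF partially_differentiableD[OF assms(1), of x i]
        partially_differentiableD[OF assms(2), of x i]]
    by (simp add: algebra_simps)
  note * = partially_differentiableI[where f' = "\<lambda>i x. partial_deriv i f x * g x + f x * partial_deriv i g x", OF this]
  show "partially_differentiable (\<lambda>x. f x * g x)"
    "partial_deriv i (\<lambda>x. f x * g x) = (\<lambda>x. partial_deriv i f x * g x + f x * partial_deriv i g x)"
    using * by simp_all
qed

lemma partial_deriv_scale:
  assumes "partially_differentiable f"
  shows "partially_differentiable (\<lambda>x. c * f x)"
    and "partial_deriv i (\<lambda>x. c * f x) = (\<lambda>x. c * partial_deriv i f x)"
  using partial_deriv_mult[OF partial_deriv_const(1)[of c] assms] by (simp_all add: partial_deriv_const)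

lemma homogeneous_partially_differentiable:
  assumes "f \<in> homogeneous_polys k"
  shows "partially_differentiable f"
  using assms unfolding homogeneous_polys_def
proof (induction rule: fun_span_induct)
  case (base f)
  then obtain \<alpha> where "f = monomial \<alpha>" by auto
  then show ?case
    using partially_differentiableI(1)[OF has_partial_deriv_monomial[of \<alpha>]] by simp
qed (auto intro: partial_deriv_const partial_deriv_add partial_deriv_scale)

lemma homogeneous_partial_deriv:
  assumes "f \<in> homogeneous_polys k"
  shows "partial_deriv i f \<in> homogeneous_polys (k - 1)"
proof -
  \<comment> \<open>Differentiability is carried through the induction, because the rules for sums
    and multiples presuppose it.\<close>
  have "partially_differentiable f \<and> partial_deriv i f \<in> homogeneous_polys (k - 1)"
    using assms unfolding homogeneous_polys_def
  proof (induction rule: fun_span_induct)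
    case (base f)
    then obtain \<alpha> where \<alpha>: "f = monomial \<alpha>" "sum \<alpha> UNIV = k" by auto
    have "(\<lambda>x. real (\<alpha> i) * monomial (\<alpha>(i := \<alpha> i - 1)) x) \<in> homogeneous_polys (k - 1)"
    proof (cases "\<alpha> i = 0")
      case True
      then show ?thesis by (simp add: homogeneous_polys_def fun_span_zero)
    next
      case False
      have "sum (\<alpha>(i := \<alpha> i - 1)) UNIV = (\<alpha> i - 1) + sum \<alpha> (UNIV - {i})"
        by (subst sum.remove[of _ i]) auto
      also have "\<dots> = k - 1"
        using False \<alpha>(2) by (subst (asm) sum.remove[of _ i]) auto
      finally show ?thesis
        unfolding homogeneous_polys_def by (intro fun_vs.span_scale fun_vs.span_base) auto
    qed
    then show ?case
      using homogeneous_partially_differentiable[OF monomial_in_homogeneous[OF \<alpha>(2)]]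
      by (simp add: \<alpha> partial_deriv_monomial homogeneous_polys_def)
  qed (auto simp: partial_deriv_const partial_deriv_add partial_deriv_scale
      intro: fun_span_zero fun_span_add fun_vs.span_scale)
  then show ?thesis ..
qed

text \<open>In degree 0 the truncated degree \<open>k - 1\<close> is again 0, so membership alone
  would not show that the derivative vanishes.\<close>

lemma homogeneous_0_partial_deriv:
  assumes "f \<in> homogeneous_polys 0"
  shows "partial_deriv i f = (\<lambda>x. 0)"
proof -
  have "partially_differentiable f \<and> partial_deriv i f = (\<lambda>x. 0)"
    using assms unfolding homogeneous_polys_def
  proof (induction rule: fun_span_induct)
    case (base f)
    then have "f = (\<lambda>x. 1)" by (auto simp: monomial_def)
    then show ?case by (simp add: partial_deriv_const)
  qed (auto simp: partial_deriv_const partial_deriv_add partial_deriv_scale)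
  then show ?thesis ..
qed

text \<open>Euler's identity: multiplication by \<open>x $ i\<close> after the i-th derivative
  multiplies a monomial by its exponent \<open>\<alpha> i\<close>, and the exponents add up to
  \<open>k\<close>.\<close>

lemma euler_homogeneous:
  assumes "f \<in> homogeneous_polys k"
  shows "(\<Sum>i\<in>UNIV. x $ i * partial_deriv i f x) = real k * f x"
proof -
  have "partially_differentiable f \<and> (\<forall>x. (\<Sum>i\<in>UNIV. x $ i * partial_deriv i f x) = real k * f x)"
    using assms unfolding homogeneous_polys_def
  proof (induction rule: fun_span_induct)
    case (base f)
    then obtain \<alpha> where \<alpha>: "f = monomial \<alpha>" "sum \<alpha> UNIV = k" by auto
    have *: "x $ i * (real (\<alpha> i) * monomial (\<alpha>(i := \<alpha> i - 1)) x) = real (\<alpha> i) * monomial \<alpha> x" for x i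
    proof (cases "\<alpha> i")
      case (Suc m)
      have "monomial \<alpha> x = x $ i ^ \<alpha> i * (\<Prod>j\<in>UNIV - {i}. x $ j ^ \<alpha> j)"
        unfolding monomial_def by (subst prod.remove[of _ i]) auto
      moreover have "monomial (\<alpha>(i := \<alpha> i - 1)) x = x $ i ^ (\<alpha> i - 1) * (\<Prod>j\<in>UNIV - {i}. x $ j ^ \<alpha> j)"
        unfolding monomial_def by (subst prod.remove[of _ i]) (auto intro!: prod.cong)
      ultimately show ?thesis using Suc by simp
    qed simp
    show ?case
      using homogeneous_partially_differentiable[OF monomial_in_homogeneous[OF \<alpha>(2)]]
      by (simp only: \<alpha>(1) partial_deriv_monomial *)
        (simp add: sum_distrib_right flip: \<alpha>(2))
  next
    case (scale c f)
    then have "(\<Sum>i\<in>UNIV. x $ i * (c * partial_deriv i f x)) = c * (real k * f x)" for x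
      by (metis (no_types, lifting) mult.left_commute sum.cong sum_distrib_left)
    with scale show ?case by (simp add: partial_deriv_scale mult.left_commute)
  qed (auto simp: partial_deriv_const partial_deriv_add algebra_simps sum.distrib)
  then show ?thesis by blast
qed

section \<open>The Laplacian on homogeneous polynomials\<close>

lemma laplacian_add_homogeneous:
  assumes "f \<in> homogeneous_polys k" "g \<in> homogeneous_polys m"
  shows "laplacian (\<lambda>x. f x + g x) = (\<lambda>x. laplacian f x + laplacian g x)"
  using assms unfolding laplacian_def
  by (simp add: partial_deriv_add homogeneous_partially_differentiable homogeneous_partial_deriv
      homogeneous_partially_differentiable[OF homogeneous_partial_deriv] sum.distrib)

lemma laplacian_scale_homogeneous:
  assumes "f \<in> homogeneous_polys k"
  shows "laplacian (\<lambda>x. c * f x) = (\<lambda>x. c * laplacian f x)"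
  using assms unfolding laplacian_def
  by (simp add: partial_deriv_scale homogeneous_partially_differentiable
      homogeneous_partially_differentiable[OF homogeneous_partial_deriv] sum_distrib_left)

lemma homogeneous_laplacian:
  assumes "f \<in> homogeneous_polys k"
  shows "laplacian f \<in> homogeneous_polys (k - 2)"
proof -
  have "partial_deriv i (partial_deriv i f) \<in> homogeneous_polys (k - 2)" for i
    using homogeneous_partial_deriv[OF homogeneous_partial_deriv[OF assms]]
    by (metis diff_diff_left one_add_one)
  then show ?thesis
    unfolding laplacian_def homogeneous_polys_def by (intro fun_span_sum) auto
qed

text \<open>This is the base case of the inductions that go down by two degrees, where
  \<open>k - 2\<close> would be truncated.\<close>

lemma laplacian_eq_0:
  assumes "f \<in> homogeneous_polys k" "k < 2"
  shows "laplacian f = (\<lambda>x. 0)"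
proof -
  have "partial_deriv i f \<in> homogeneous_polys 0" for i
    using homogeneous_partial_deriv[OF assms(1), of i] assms(2) by (cases k) auto
  then show ?thesis by (simp add: laplacian_def homogeneous_0_partial_deriv)
qed

section \<open>Harmonic decomposition of homogeneous polynomials\<close>

lemma partial_deriv_component: "partial_deriv i (\<lambda>x. x $ j) = (\<lambda>x. if i = j then 1 else 0)"
  by (rule partially_differentiableI(2)) (auto intro!: derivative_eq_intros simp: axis_def)

lemma partial_deriv_norm2: "partial_deriv i (\<lambda>x. x \<bullet> x) = (\<lambda>x. 2 * x $ i)"
proof -
  have "(x + t *\<^sub>R axis i 1) \<bullet> (x + t *\<^sub>R axis i 1) = x \<bullet> x + 2 * t * x $ i + t * t" for t and x :: "real ^ 'a" and i
    by (simp add: inner_axis inner_axis' inner_add inner_commute algebra_simps)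
  then show ?thesis
    by (intro partially_differentiableI(2)) (auto intro!: derivative_eq_intros)
qed

text \<open>By the product rule, \<open>2 * CARD('d)\<close> is the Laplacian of |x|^2, and the
  mixed terms add up to four times the Euler sum, that is \<open>4 * k * f\<close>.\<close>

lemma laplacian_norm2_mult:
  fixes f :: "real ^ 'd::finite \<Rightarrow> real"
  assumes f: "f \<in> homogeneous_polys k"
  shows "laplacian (\<lambda>x. (x \<bullet> x) * f x) x =
    (2 * real CARD('d) + 4 * real k) * f x + (x \<bullet> x) * laplacian f x"
proof -
  note df = homogeneous_partially_differentiable
  note d1 = df[OF f] and d2 = df[OF homogeneous_norm2] and d3 = df[OF homogeneous_component]
    and d4 = df[OF homogeneous_partial_deriv[OF f]]
  have 1: "partial_deriv i (\<lambda>x. (x \<bullet> x) * f x) = (\<lambda>x. 2 * (x $ i * f x) + (x \<bullet> x) * partial_deriv i f x)" for i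
    by (simp add: partial_deriv_mult[OF d2 d1] partial_deriv_norm2 mult.assoc)
  have 2: "partial_deriv i (\<lambda>x. 2 * (x $ i * f x) + (x \<bullet> x) * partial_deriv i f x) x =
     2 * f x + 4 * (x $ i * partial_deriv i f x) + (x \<bullet> x) * partial_deriv i (partial_deriv i f) x" for i
    by (subst partial_deriv_add)
      (simp_all add: partial_deriv_mult d1 d2 d3 d4 partial_deriv_scale partial_deriv_component
        partial_deriv_norm2)
  have "laplacian (\<lambda>x. (x \<bullet> x) * f x) x = 2 * real CARD('d) * f x
      + 4 * (\<Sum>i\<in>UNIV. x $ i * partial_deriv i f x) + (x \<bullet> x) * laplacian f x"
    unfolding laplacian_def 1 2 by (simp add: sum.distrib sum_distrib_left)
  then show ?thesis by (simp add: euler_homogeneous[OF f] algebra_simps)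
qed

lemma homogeneous_norm2_mult:
  "f \<in> homogeneous_polys k \<Longrightarrow> (\<lambda>x. (x \<bullet> x) * f x) \<in> homogeneous_polys (k + 2)"
  using homogeneous_mult[OF homogeneous_norm2] by (simp add: add.commute)

text \<open>The ansatz \<open>q = (g - |x|\<^sup>2 r) / c\<close> leads to the same equation for \<open>r\<close>, in degree \<open>k - 2\<close>
  and with a larger constant.\<close>

lemma solve_laplacian_perturbation:
  fixes g :: "real ^ 'd::finite \<Rightarrow> real"
  assumes "c > 0" "g \<in> homogeneous_polys k"
  shows "\<exists>q\<in>homogeneous_polys k. \<forall>x. c * q x + (x \<bullet> x) * laplacian q x = g x"
  using assms
proof (induction k arbitrary: c g rule: less_induct)
  case (less k)
  show ?case
  proof (cases "k < 2")
    case True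
    have "(\<lambda>x. (1 / c) * g x) \<in> homogeneous_polys k"
      using less.prems(2) unfolding homogeneous_polys_def by (rule fun_vs.span_scale)
    with True less.prems(1) laplacian_eq_0[OF this True] show ?thesis
      by (intro bexI[of _ "\<lambda>x. (1 / c) * g x"]) auto
  next
    case False
    \<comment> \<open>Applying the Laplacian to \<open>c * q = g - |x|^2 * r\<close> and asking for
      \<open>laplacian q = r\<close> gives
      \<open>c' * r + |x|^2 * laplacian r = laplacian g\<close>; the summand added to
      \<open>c\<close> is the constant of \<open>laplacian_norm2_mult\<close> in degree
      \<open>k - 2\<close>.\<close>
    define c' where "c' = c + (2 * real CARD('d) + 4 * real (k - 2))"
    have "c' > 0" using less.prems(1) by (simp add: c'_def add_pos_nonneg)
    then obtain r where r: "r \<in> homogeneous_polys (k - 2)"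
      and req: "\<And>x. c' * r x + (x \<bullet> x) * laplacian r x = laplacian g x"
      using less.IH[of "k - 2" c' "laplacian g"] False homogeneous_laplacian[OF less.prems(2)] by auto
    define s where "s = (\<lambda>x. - 1 * ((x \<bullet> x) * r x))"
    have xr: "(\<lambda>x. (x \<bullet> x) * r x) \<in> homogeneous_polys k"
      using homogeneous_norm2_mult[OF r] False by (metis le_add_diff_inverse2 not_less)
    then have s: "s \<in> homogeneous_polys k"
      unfolding s_def homogeneous_polys_def by (rule fun_vs.span_scale)
    have gs: "(\<lambda>x. g x + s x) \<in> homogeneous_polys k"
      using less.prems(2) s unfolding homogeneous_polys_def by (rule fun_span_add)
    define q where "q = (\<lambda>x. (1 / c) * (g x + s x))"
    have q: "q \<in> homogeneous_polys k"
      using gs unfolding q_def homogeneous_polys_def by (rule fun_vs.span_scale)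
    have "laplacian s x = - laplacian (\<lambda>x. (x \<bullet> x) * r x) x" for x
      unfolding s_def using laplacian_scale_homogeneous[OF xr, of "- 1"] by simp
    then have "laplacian q x = (1 / c) * (laplacian g x - (c' - c) * r x - (x \<bullet> x) * laplacian r x)" for x
      unfolding q_def laplacian_scale_homogeneous[OF gs] laplacian_add_homogeneous[OF less.prems(2) s]
      by (simp add: laplacian_norm2_mult[OF r] c'_def)
    moreover have "laplacian g x - (c' - c) * r x - (x \<bullet> x) * laplacian r x = c * r x" for x
      using req[of x] by (simp add: algebra_simps)
    ultimately have "laplacian q x = r x" for x
      using less.prems(1) by simp
    then have "\<forall>x. c * q x + (x \<bullet> x) * laplacian q x = g x"
      using less.prems(1) by (simp add: q_def s_def)
    with q show ?thesis by blast
  qed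
qed

lemma sphere_restrict_add:
  "sphere_restrict (\<lambda>x. f x + g x) = (\<lambda>x. sphere_restrict f x + sphere_restrict g x)"
  by (auto simp: sphere_restrict_def)

lemma sphere_restrict_scale: "sphere_restrict (\<lambda>x. c * f x) = (\<lambda>x. c * sphere_restrict f x)"
  by (auto simp: sphere_restrict_def)

lemma sphere_restrict_zero: "sphere_restrict (\<lambda>x. 0) = (\<lambda>x. 0)"
  by (auto simp: sphere_restrict_def)

text \<open>For a suitable \<open>q\<close> of degree \<open>k - 2\<close> the polynomial
  \<open>p - |x|^2 * q\<close> is harmonic. On the sphere |x|^2 is 1, so \<open>p\<close> becomes a
  harmonic plus \<open>q\<close>, and induction treats \<open>q\<close>.\<close>

lemma homogeneous_harmonic_decomposition:
  fixes p :: "real ^ 'd::finite \<Rightarrow> real"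
  assumes "p \<in> homogeneous_polys k"
  shows "sphere_restrict p \<in> fun_vs.span (\<Union>i\<le>k. spherical_harmonics i)"
  using assms
proof (induction k arbitrary: p rule: less_induct)
  case (less k)
  show ?case
  proof (cases "k < 2")
    case True
    then have "sphere_restrict p \<in> spherical_harmonics k"
      using less.prems laplacian_eq_0[OF less.prems] by (auto simp: spherical_harmonics_def)
    then show ?thesis by (intro fun_vs.span_base) auto
  next
    case False
    \<comment> \<open>The equation says that \<open>|x|^2 * q\<close> and \<open>p\<close> have the
      same Laplacian. It is solvable because the constant in front of \<open>q\<close> is
      positive.\<close>
    obtain q where q: "q \<in> homogeneous_polys (k - 2)"
      and qeq: "\<And>x. (2 * real CARD('d) + 4 * real (k - 2)) * q x + (x \<bullet> x) * laplacian q x = laplacian p x"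
      using solve_laplacian_perturbation[OF _ homogeneous_laplacian[OF less.prems]]
      by (metis add_pos_nonneg of_nat_0_less_iff of_nat_0_le_iff zero_less_card_finite
          mult_nonneg_nonneg mult_pos_pos zero_le_numeral zero_less_numeral)
    define s where "s = (\<lambda>x. - 1 * ((x \<bullet> x) * q x))"
    have xq: "(\<lambda>x. (x \<bullet> x) * q x) \<in> homogeneous_polys k"
      using homogeneous_norm2_mult[OF q] False by (metis le_add_diff_inverse2 not_less)
    then have s: "s \<in> homogeneous_polys k"
      unfolding s_def homogeneous_polys_def by (rule fun_vs.span_scale)
    have "laplacian s x = - laplacian (\<lambda>x. (x \<bullet> x) * q x) x" for x
      unfolding s_def using laplacian_scale_homogeneous[OF xq, of "- 1"] by simp
    then have "laplacian (\<lambda>x. p x + s x) x = 0" for x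
      unfolding laplacian_add_homogeneous[OF less.prems s]
      using qeq[of x] by (simp add: laplacian_norm2_mult[OF q])
    moreover have "(\<lambda>x. p x + s x) \<in> homogeneous_polys k"
      using less.prems s unfolding homogeneous_polys_def by (rule fun_span_add)
    ultimately have "sphere_restrict (\<lambda>x. p x + s x) \<in> spherical_harmonics k"
      by (auto simp: spherical_harmonics_def)
    then have 1: "sphere_restrict (\<lambda>x. p x + s x) \<in> fun_vs.span (\<Union>i\<le>k. spherical_harmonics i)"
      by (intro fun_vs.span_base) auto
    have "sphere_restrict q \<in> fun_vs.span (\<Union>i\<le>k - 2. spherical_harmonics i)"
      using less.IH[of "k - 2"] q False by simp
    also have "\<dots> \<subseteq> fun_vs.span (\<Union>i\<le>k. spherical_harmonics i)"
      by (intro fun_vs.span_mono UN_mono) auto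
    finally have 2: "sphere_restrict q \<in> fun_vs.span (\<Union>i\<le>k. spherical_harmonics i)" .
    have "sphere_restrict p = (\<lambda>x. sphere_restrict (\<lambda>x. p x + s x) x + sphere_restrict q x)"
      by (auto simp: sphere_restrict_def s_def fun_eq_iff norm_eq_1)
    with fun_span_add[OF 1 2] show ?thesis by simp
  qed
qed

section \<open>Packing and a localised kernel\<close>

text \<open>Volume comparison: the balls of radius \<open>\<delta> / 2\<close> about the points of
  \<open>S\<close> are disjoint and lie in the ball of radius \<open>R + \<delta> / 2\<close> about
  \<open>x\<close>.\<close>

lemma packing_card_le:
  fixes S :: "'a::euclidean_space set"
  assumes S: "finite S" and "\<delta> > 0" "R \<ge> 0"
    and sep: "\<And>y z. y \<in> S \<Longrightarrow> z \<in> S \<Longrightarrow> y \<noteq> z \<Longrightarrow> \<delta> \<le> dist y z"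
    and near: "\<And>y. y \<in> S \<Longrightarrow> dist x y \<le> R"
  shows "real (card S) \<le> (2 * R / \<delta> + 1) ^ DIM('a)"
proof -
  define v where "v = unit_ball_vol (real DIM('a))"
  have "v > 0" by (simp add: v_def)
  have disj: "disjoint_family_on (\<lambda>y. ball y (\<delta> / 2)) S"
    unfolding disjoint_family_on_def
  proof (intro ballI impI)
    fix y z assume "y \<in> S" "z \<in> S" "y \<noteq> z"
    then have "\<delta> \<le> dist y z" by (rule sep)
    then show "ball y (\<delta> / 2) \<inter> ball z (\<delta> / 2) = {}"
      by (intro disjoint_ballI) simp
  qed
  have "real (card S) * (v * (\<delta> / 2) ^ DIM('a)) = (\<Sum>y\<in>S. measure lborel (ball y (\<delta> / 2)))"
    using \<open>\<delta> > 0\<close> by (simp add: content_ball v_def)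
  also have "\<dots> = measure lborel (\<Union>y\<in>S. ball y (\<delta> / 2))"
    using emeasure_lborel_ball_finite
    by (intro measure_finite_Union[symmetric] S disj) (auto simp: less_top)
  also have "\<dots> \<le> measure lborel (cball x (R + \<delta> / 2))"
  proof (rule measure_mono_fmeasurable)
    show "(\<Union>y\<in>S. ball y (\<delta> / 2)) \<subseteq> cball x (R + \<delta> / 2)"
    proof clarsimp
      fix y z assume "y \<in> S" "dist y z * 2 < \<delta>"
      then show "dist x z \<le> R + \<delta> / 2" using dist_triangle[of x z y] near[of y] by simp
    qed
  qed (use emeasure_lborel_cball_finite in \<open>auto intro!: fmeasurableI borel_open simp: less_top\<close>)
  also have "\<dots> = v * (R + \<delta> / 2) ^ DIM('a)"
    using assms(2,3) by (simp add: content_cball v_def)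
  finally have "real (card S) * (\<delta> / 2) ^ DIM('a) \<le> (R + \<delta> / 2) ^ DIM('a)"
    using \<open>v > 0\<close> by (simp add: mult.left_commute)
  moreover have "R + \<delta> / 2 = (2 * R / \<delta> + 1) * (\<delta> / 2)"
    using \<open>\<delta> > 0\<close> by (simp add: field_simps)
  ultimately have "real (card S) * (\<delta> / 2) ^ DIM('a) \<le> (2 * R / \<delta> + 1) ^ DIM('a) * (\<delta> / 2) ^ DIM('a)"
    by (simp only: power_mult_distrib)
  then show ?thesis
    by (rule mult_right_le_imp_le) (use \<open>\<delta> > 0\<close> in simp)
qed

text \<open>Each base is at most 1, so exponent 2 is the worst case. The first term is then at most
  0.8^2 = 0.64, and the others are dominated by the telescoping series of
  \<open>0.3136 / (k * (k + 1))\<close>; the total stays below 0.9536.\<close>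

lemma shell_bound_sum_less_one:
  assumes "D \<ge> 2"
  shows "(\<Sum>k=1..K. ((2 * real k + 3) * (4 / 25 / real k ^ 2)) ^ D) < 1"
proof -
  define b where "b = (\<lambda>k::nat. (2 * real k + 3) * (4 / 25 / real k ^ 2))"
  have le1: "b k ^ D \<le> b k ^ 2" if "b k \<le> 1" for k
    using that assms by (intro power_decreasing) (auto simp: b_def)
  have b1: "b 1 ^ D \<le> 0.64"
    using le1[of 1] by (simp add: b_def power2_eq_square)
  have bk: "b (Suc k) ^ D \<le> 0.3136 * (1 / real k - 1 / real (Suc k))" if "k \<ge> 1" for k
  proof -
    have "b (Suc k) \<le> 0.56 / real (Suc k)"
    proof -
      \<comment> \<open>For \<open>x \<ge> 2\<close> one has \<open>2 * x + 3 \<le> 3.5 * x\<close>,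
        and 3.5 * 4 / 25 = 0.56.\<close>
      define x where "x = real (Suc k)"
      have "x \<ge> 2" using that by (simp add: x_def)
      then have "(2 * x + 3) * (4 / 25) / x ^ 2 \<le> (0.56 * x) / x ^ 2"
        by (intro divide_right_mono) auto
      moreover have "(0.56 * x) / x ^ 2 = 0.56 / x"
        using \<open>x \<ge> 2\<close> by (simp add: power2_eq_square)
      moreover have "b (Suc k) = (2 * x + 3) * (4 / 25) / x ^ 2" by (simp add: b_def x_def)
      ultimately show ?thesis by (simp only: x_def)
    qed
    moreover have "0.56 / real (Suc k) \<le> 1" by simp
    ultimately have "b (Suc k) ^ D \<le> b (Suc k) ^ 2" by (intro le1) linarith
    also have "\<dots> \<le> (0.56 / real (Suc k)) ^ 2"
      using \<open>b (Suc k) \<le> _\<close> by (intro power_mono) (auto simp: b_def)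
    also have "\<dots> \<le> 0.3136 * (1 / real k - 1 / real (Suc k))"
    proof -
      have "1 / real (Suc k) ^ 2 \<le> 1 / (real k * real (Suc k))"
        using that by (intro divide_left_mono) (auto simp: power2_eq_square)
      also have "\<dots> = 1 / real k - 1 / real (Suc k)"
        using that by (simp add: field_simps)
      finally have "0.3136 * (1 / real (Suc k) ^ 2) \<le> 0.3136 * (1 / real k - 1 / real (Suc k))"
        by (rule mult_left_mono) simp
      moreover have "(0.56 / y) ^ 2 = 0.3136 * (1 / y ^ 2)" for y :: real
        by (simp add: power_divide power2_eq_square)
      ultimately show ?thesis by (simp only:)
    qed
    finally show ?thesis .
  qed
  have "(\<Sum>k=1..Suc K. b k ^ D) \<le> 0.64 + 0.3136 * (1 - 1 / real (Suc K))" for K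
  proof (induction K)
    case 0
    then show ?case using b1 by simp
  next
    case (Suc K)
    have "(\<Sum>k=1..Suc (Suc K). b k ^ D) = (\<Sum>k=1..Suc K. b k ^ D) + b (Suc (Suc K)) ^ D"
      by simp
    also have "\<dots> \<le> 0.64 + 0.3136 * (1 - 1 / real (Suc (Suc K)))"
      using Suc bk[of "Suc K"] by (simp add: algebra_simps)
    finally show ?case .
  qed
  moreover have "0.64 + 0.3136 * (1 - 1 / real (Suc K)) < (1::real)" for K
    by (simp add: field_simps)
  ultimately have "(\<Sum>k=1..Suc K. b k ^ D) < 1" for K
    by (meson le_less_trans)
  \<comment> \<open>The bound so far is for sums with at least one term; adding a nonnegative term
    covers \<open>K = 0\<close> as well.\<close>
  moreover have "(\<Sum>k=1..K. b k ^ D) \<le> (\<Sum>k=1..Suc K. b k ^ D)"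
    by (intro sum_mono2) (auto simp: b_def)
  ultimately show ?thesis unfolding b_def by (meson le_less_trans)
qed

text \<open>The points are sorted into shells by the integer part \<open>k\<close> of
  \<open>dist x y / \<delta>\<close>. On shell \<open>k\<close> each summand is at most
  \<open>(4 / 25 / k^2) ^ DIM('a)\<close>, and packing with \<open>R = (k + 1) * \<delta>\<close>
  allows at most \<open>(2 * k + 3) ^ DIM('a)\<close> points.\<close>

lemma separated_sum_less_one:
  fixes S :: "'a::euclidean_space set"
  assumes "DIM('a) \<ge> 2" and S: "finite S" and "\<delta> > 0"
    and sep: "\<And>y z. y \<in> S \<Longrightarrow> z \<in> S \<Longrightarrow> y \<noteq> z \<Longrightarrow> \<delta> \<le> dist y z"
    and away: "\<And>y. y \<in> S \<Longrightarrow> \<delta> \<le> dist x y"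
  shows "(\<Sum>y\<in>S. (4 / 25 * (\<delta> / dist x y) ^ 2) ^ DIM('a)) < 1"
proof -
  define \<kappa> where "\<kappa> = (\<lambda>y. nat \<lfloor>dist x y / \<delta>\<rfloor>)"
  \<comment> \<open>The inserted 0 keeps the maximum defined when \<open>S\<close> is empty.\<close>
  define K where "K = Max (insert 0 (\<kappa> ` S))"
  have \<kappa>: "1 \<le> \<kappa> y" "real (\<kappa> y) * \<delta> \<le> dist x y" "dist x y \<le> (real (\<kappa> y) + 1) * \<delta>" if "y \<in> S" for y
  proof -
    have "1 \<le> dist x y / \<delta>" using away[OF that] \<open>\<delta> > 0\<close> by simp
    then have fl: "1 \<le> \<lfloor>dist x y / \<delta>\<rfloor>" by (simp add: le_floor_iff)
    have *: "1 \<le> \<kappa> y" "real (\<kappa> y) = of_int \<lfloor>dist x y / \<delta>\<rfloor>"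
      using nat_mono[OF fl] of_nat_nat[OF order_trans[OF zero_le_one fl]]
      by (simp_all only: \<kappa>_def nat_1 One_nat_def)
    then have "real (\<kappa> y) \<le> dist x y / \<delta>" "dist x y / \<delta> \<le> real (\<kappa> y) + 1" by linarith+
    with * show "1 \<le> \<kappa> y" "real (\<kappa> y) * \<delta> \<le> dist x y" "dist x y \<le> (real (\<kappa> y) + 1) * \<delta>"
      using pos_le_divide_eq[OF \<open>\<delta> > 0\<close>] pos_divide_le_eq[OF \<open>\<delta> > 0\<close>] by blast+
  qed
  have "\<kappa> ` S \<subseteq> {1..K}"
    using \<kappa>(1) S by (auto simp: K_def)
  then have "(\<Sum>y\<in>S. (4 / 25 * (\<delta> / dist x y) ^ 2) ^ DIM('a)) =
      (\<Sum>k=1..K. \<Sum>y\<in>{y\<in>S. \<kappa> y = k}. (4 / 25 * (\<delta> / dist x y) ^ 2) ^ DIM('a))"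
    using S by (intro sum.group[symmetric]) auto
  also have "\<dots> \<le> (\<Sum>k=1..K. ((2 * real k + 3) * (4 / 25 / real k ^ 2)) ^ DIM('a))"
  proof (intro sum_mono)
    fix k assume k: "k \<in> {1..K}"
    let ?S = "{y\<in>S. \<kappa> y = k}"
    have "\<delta> / dist x y \<le> 1 / real k" if "y \<in> ?S" for y
      using \<kappa>[of y] that \<open>\<delta> > 0\<close> k zero_less_dist_iff[of x y]
      by (simp add: divide_simps mult.commute split: if_splits)
    then have "(4 / 25 * (\<delta> / dist x y) ^ 2) ^ DIM('a) \<le> (4 / 25 * (1 / real k) ^ 2) ^ DIM('a)"
      if "y \<in> ?S" for y
      using that \<open>\<delta> > 0\<close> by (intro power_mono mult_left_mono) auto
    then have "(\<Sum>y\<in>?S. (4 / 25 * (\<delta> / dist x y) ^ 2) ^ DIM('a))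
        \<le> real (card ?S) * (4 / 25 * (1 / real k) ^ 2) ^ DIM('a)"
      by (rule sum_bounded_above)
    also have "\<dots> \<le> (2 * ((real k + 1) * \<delta>) / \<delta> + 1) ^ DIM('a) * (4 / 25 * (1 / real k) ^ 2) ^ DIM('a)"
      using S sep \<kappa>(3) \<open>\<delta> > 0\<close> by (intro mult_right_mono packing_card_le[where x = x]) auto
    also have "2 * ((real k + 1) * \<delta>) / \<delta> + 1 = 2 * real k + 3"
      using \<open>\<delta> > 0\<close> by simp
    also have "4 / 25 * (1 / real k) ^ 2 = 4 / 25 / real k ^ 2"
      by (simp add: power_divide)
    finally show "(\<Sum>y\<in>?S. (4 / 25 * (\<delta> / dist x y) ^ 2) ^ DIM('a))
        \<le> ((2 * real k + 3) * (4 / 25 / real k ^ 2)) ^ DIM('a)"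
      by (simp only: power_mult_distrib)
  qed
  also have "\<dots> < 1" by (rule shell_bound_sum_less_one[OF assms(1)])
  finally show ?thesis .
qed

text \<open>\<open>fejer N (cos \<theta>)\<close> is \<open>N\<close> times the Fejer kernel,
  \<open>(1 - cos (N * \<theta>)) / (1 - cos \<theta>)\<close>; the recursion exhibits it as a
  polynomial of degree \<open>N - 1\<close> in \<open>cos \<theta>\<close>.\<close>

fun fejer :: "nat \<Rightarrow> real \<Rightarrow> real" where
  "fejer 0 t = 0"
| "fejer (Suc 0) t = 1"
| "fejer (Suc (Suc N)) t = 2 * t * fejer (Suc N) t - fejer N t + 2"

text \<open>The numbers 1 - cos(N \<theta>) satisfy the Chebyshev recursion of the cosines up to the
  inhomogeneous term 2 (1 - cos \<theta>); division by 1 - cos \<theta> turns it into the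
  \<open>+ 2\<close> of the definition.\<close>

lemma fejer_cos: "(1 - cos \<theta>) * fejer N (cos \<theta>) = 1 - cos (real N * \<theta>)"
proof (induction N rule: induct_nat_012)
  case (ge2 N)
  have "cos (real (Suc (Suc N)) * \<theta>) + cos (real N * \<theta>) = 2 * cos \<theta> * cos (real (Suc N) * \<theta>)"
    using cos_add[of "real (Suc N) * \<theta>" \<theta>] cos_diff[of "real (Suc N) * \<theta>" \<theta>]
    by (simp add: algebra_simps)
  moreover have "(1 - cos \<theta>) * fejer (Suc (Suc N)) (cos \<theta>) =
      2 * cos \<theta> * ((1 - cos \<theta>) * fejer (Suc N) (cos \<theta>)) - (1 - cos \<theta>) * fejer N (cos \<theta>) + 2 * (1 - cos \<theta>)"
    by (simp add: algebra_simps)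
  ultimately show ?case by (simp only: ge2) (simp add: algebra_simps)
qed auto

text \<open>The closed formula degenerates to 0 = 0 at 1, so the diagonal value comes from the
  recursion.\<close>

lemma fejer_one: "fejer N 1 = real N ^ 2"
  by (induction N rule: induct_nat_012) (auto simp: power2_eq_square algebra_simps)

text \<open>The numerator 1 - cos(N \<theta>) lies between 0 and 2. On the sphere
  \<open>1 - t\<close> is half the squared distance, which makes this the decay of the
  kernel.\<close>

lemma fejer_bounds:
  assumes "- 1 \<le> t" "t < 1"
  shows "0 \<le> fejer N t" "fejer N t \<le> 2 / (1 - t)"
proof -
  have "fejer N t = (1 - cos (real N * arccos t)) / (1 - t)"
    using fejer_cos[of "arccos t" N] assms by (simp add: field_simps)
  moreover have "0 \<le> 1 - cos (real N * arccos t)" by simp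
  moreover have "1 - cos (real N * arccos t) \<le> 2" using cos_ge_minus_one[of "real N * arccos t"] by linarith
  ultimately show "0 \<le> fejer N t" "fejer N t \<le> 2 / (1 - t)"
    using assms by (simp_all add: divide_right_mono)
qed

lemma poly_funs_fejer: "(\<lambda>x. fejer N (a \<bullet> x)) \<in> poly_funs (N - 1)"
proof (induction N rule: induct_nat_012)
  case (ge2 N)
  have "(\<lambda>x. 2 * ((a \<bullet> x) * fejer (Suc N) (a \<bullet> x))) \<in> poly_funs (Suc N)"
    using poly_funs_scale[OF poly_funs_mult[OF poly_funs_inner ge2(2)]] by simp
  moreover have "(\<lambda>x. fejer N (a \<bullet> x)) \<in> poly_funs (Suc N)"
    using ge2(1) poly_funs_mono[OF le_SucI[OF diff_le_self]] by blast
  ultimately show ?case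
    by (auto simp: mult.assoc intro!: poly_funs_add poly_funs_diff poly_funs_const)
qed (auto intro: poly_funs_const)

section \<open>Inner products on the sphere and independence of point evaluations\<close>

lemma dist_sphere:
  fixes x y :: "'a::real_inner"
  assumes "x \<in> sphere 0 1" "y \<in> sphere 0 1"
  shows "dist x y ^ 2 = 2 - 2 * (x \<bullet> y)"
  using assms by (simp add: dist_norm power2_norm_eq_inner norm_eq_1 inner_diff inner_commute)

lemma inner_sphere_bounds:
  fixes x y :: "'a::real_inner"
  assumes "x \<in> sphere 0 1" "y \<in> sphere 0 1"
  shows "- 1 \<le> x \<bullet> y" and "x \<noteq> y \<Longrightarrow> x \<bullet> y < 1"
proof -
  have "\<bar>x \<bullet> y\<bar> \<le> 1" using Cauchy_Schwarz_ineq2[of x y] assms by simp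
  then show "- 1 \<le> x \<bullet> y" by simp
  show "x \<bullet> y < 1" if "x \<noteq> y"
  proof -
    have "0 < dist x y ^ 2" using that by simp
    then show ?thesis using dist_sphere[OF assms] by linarith
  qed
qed

text \<open>The matrix \<open>(fejer N (x \<bullet> y) / N\<^sup>2) ^ CARD('d)\<close>, \<open>x, y \<in> S\<close>, is strictly diagonally
  dominant.\<close>

lemma evaluations_independent:
  fixes S :: "(real ^ 'd::finite) set"
  assumes "CARD('d) \<ge> 2" and S: "finite S" "S \<subseteq> sphere 0 1" and "\<delta> > 0"
    and sep: "\<And>y z. y \<in> S \<Longrightarrow> z \<in> S \<Longrightarrow> y \<noteq> z \<Longrightarrow> \<delta> \<le> dist y z"
    and N: "5 \<le> real N * \<delta>" "CARD('d) * (N - 1) \<le> m"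
    and c: "\<And>p. p \<in> poly_funs m \<Longrightarrow> (\<Sum>y\<in>S. c y * p y) = 0"
    and "z \<in> S"
  shows "c z = 0"
proof -
  have "N > 0" using N(1) by (cases N) auto
  \<comment> \<open>The usual argument for diagonal dominance: row \<open>x\<close> of the kernel
    matrix is tested, with \<open>x\<close> an index at which the coefficient is largest in
    modulus.\<close>
  obtain x where x: "x \<in> S" and max: "\<And>y. y \<in> S \<Longrightarrow> \<bar>c y\<bar> \<le> \<bar>c x\<bar>"
  proof -
    have "Max ((\<lambda>y. \<bar>c y\<bar>) ` S) \<in> (\<lambda>y. \<bar>c y\<bar>) ` S"
      using S(1) \<open>z \<in> S\<close> by (intro Max_in) auto
    then obtain x where "x \<in> S" "Max ((\<lambda>y. \<bar>c y\<bar>) ` S) = \<bar>c x\<bar>" by auto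
    moreover from this have "\<bar>c y\<bar> \<le> \<bar>c x\<bar>" if "y \<in> S" for y
      using Max_ge[of "(\<lambda>y. \<bar>c y\<bar>) ` S" "\<bar>c y\<bar>"] S(1) that by auto
    ultimately show thesis using that by blast
  qed
  \<comment> \<open>This is row \<open>x\<close> of the kernel matrix; the factor
    \<open>1 / N^2\<close> makes the diagonal entry 1.\<close>
  define p where "p = (\<lambda>y. (1 / real N ^ 2 * fejer N (x \<bullet> y)) ^ CARD('d))"
  have "p \<in> poly_funs (CARD('d) * (N - 1))"
    unfolding p_def by (intro poly_funs_power poly_funs_scale poly_funs_fejer)
  then have "p \<in> poly_funs m" using poly_funs_mono[OF N(2)] by blast
  then have "(\<Sum>y\<in>S. c y * p y) = 0" by (rule c)
  moreover have "p x = 1"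
    using x S(2) \<open>N > 0\<close> by (auto simp: p_def norm_eq_1 fejer_one subset_iff)
  ultimately have "c x = - (\<Sum>y\<in>S - {x}. c y * p y)"
    using sum.remove[OF S(1) x, of "\<lambda>y. c y * p y"] by simp
  then have "\<bar>c x\<bar> \<le> (\<Sum>y\<in>S - {x}. \<bar>c y * p y\<bar>)" by (simp add: sum_abs)
  also have "\<dots> \<le> (\<Sum>y\<in>S - {x}. \<bar>c x\<bar> * (4 / 25 * (\<delta> / dist x y) ^ 2) ^ DIM(real ^ 'd))"
  proof (intro sum_mono)
    fix y assume y: "y \<in> S - {x}"
    then have xy: "x \<in> sphere 0 1" "y \<in> sphere 0 1" "x \<noteq> y" using S(2) x by auto
    note bounds = inner_sphere_bounds[OF xy(1,2)]
    note F = fejer_bounds[OF bounds(1) bounds(2)[OF xy(3)], of N]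
    \<comment> \<open>This is \<open>5 \<le> N * \<delta>\<close> squared. Together with the factor
      4 from \<open>2 / (1 - x \<bullet> y)\<close> it produces the constant 4 / 25 of
      \<open>separated_sum_less_one\<close>.\<close>
    have "1 / real N ^ 2 \<le> \<delta> ^ 2 / 25"
      using power_mono[OF N(1), of 2] \<open>N > 0\<close> by (simp add: field_simps power_mult_distrib)
    then have "1 / real N ^ 2 * fejer N (x \<bullet> y) \<le> \<delta> ^ 2 / 25 * (2 / (1 - x \<bullet> y))"
      using F by (intro mult_mono) auto
    also have "2 / (1 - x \<bullet> y) = 4 / dist x y ^ 2"
      using bounds(2)[OF xy(3)] by (simp add: dist_sphere[OF xy(1,2)] field_simps)
    also have "\<delta> ^ 2 / 25 * (4 / dist x y ^ 2) = 4 / 25 * (\<delta> / dist x y) ^ 2"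
      by (simp add: power_divide)
    finally have "p y \<le> (4 / 25 * (\<delta> / dist x y) ^ 2) ^ CARD('d)"
      unfolding p_def using F(1) by (intro power_mono) auto
    moreover have "0 \<le> p y" using F(1) by (simp add: p_def)
    ultimately show "\<bar>c y * p y\<bar> \<le> \<bar>c x\<bar> * (4 / 25 * (\<delta> / dist x y) ^ 2) ^ DIM(real ^ 'd)"
      using max[of y] y by (simp add: abs_mult mult_mono)
  qed
  also have "\<dots> = \<bar>c x\<bar> * (\<Sum>y\<in>S - {x}. (4 / 25 * (\<delta> / dist x y) ^ 2) ^ DIM(real ^ 'd))"
    by (simp add: sum_distrib_left)
  finally have "\<bar>c x\<bar> \<le> \<bar>c x\<bar> * (\<Sum>y\<in>S - {x}. (4 / 25 * (\<delta> / dist x y) ^ 2) ^ DIM(real ^ 'd))" .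
  moreover have "(\<Sum>y\<in>S - {x}. (4 / 25 * (\<delta> / dist x y) ^ 2) ^ DIM(real ^ 'd)) < 1"
    using assms(1) S(1) \<open>\<delta> > 0\<close> sep x by (intro separated_sum_less_one) auto
  ultimately have "c x = 0"
    using mult_strict_left_mono[of _ 1 "\<bar>c x\<bar>"] by fastforce
  then show ?thesis using max[OF \<open>z \<in> S\<close>] by simp
qed

section \<open>Lagrange functions and polynomials separating a point from the nodes\<close>

text \<open>Linearly independent functionals admit a dual family. The hypothesis is the independence
  of the evaluations at \<open>S\<close>, and the dual family is built by induction on
  \<open>S\<close>.\<close>

lemma lagrange_functions:
  assumes "finite S"
    and "\<And>c. (\<And>p. p \<in> fun_vs.span B \<Longrightarrow> (\<Sum>y\<in>S. c y * p y) = 0) \<Longrightarrow> \<forall>y\<in>S. c y = 0"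
  shows "\<exists>l. \<forall>s\<in>S. l s \<in> fun_vs.span B \<and> (\<forall>t\<in>S. l s t = (if s = t then 1 else 0))"
  using assms
proof (induction S)
  case (insert a S)
  have "\<exists>l. \<forall>s\<in>S. l s \<in> fun_vs.span B \<and> (\<forall>t\<in>S. l s t = (if s = t then 1 else 0))"
  proof (rule insert.IH)
    fix c assume c: "\<And>p. p \<in> fun_vs.span B \<Longrightarrow> (\<Sum>y\<in>S. c y * p y) = 0"
    \<comment> \<open>Independence passes to the smaller set by extending the coefficients with 0 at
      \<open>a\<close>.\<close>
    have "\<forall>y\<in>insert a S. (c(a := 0)) y = 0"
    proof (rule insert.prems)
      fix p assume "p \<in> fun_vs.span B"
      have "(\<Sum>y\<in>insert a S. (c(a := 0)) y * p y) = (\<Sum>y\<in>S. (c(a := 0)) y * p y)"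
        using insert.hyps by simp
      also have "\<dots> = (\<Sum>y\<in>S. c y * p y)" using insert.hyps by (intro sum.cong) auto
      finally show "(\<Sum>y\<in>insert a S. (c(a := 0)) y * p y) = 0" using c[OF \<open>p \<in> _\<close>] by simp
    qed
    then show "\<forall>y\<in>S. c y = 0" using insert.hyps by (auto split: if_splits)
  qed
  then obtain l where l: "\<And>s. s \<in> S \<Longrightarrow> l s \<in> fun_vs.span B"
    and ld: "\<And>s t. s \<in> S \<Longrightarrow> t \<in> S \<Longrightarrow> l s t = (if s = t then 1 else 0)" by blast
  \<comment> \<open>If every function vanishing on \<open>S\<close> vanished at \<open>a\<close>,
    then \<open>p a\<close> would equal the sum of \<open>p s * l s a\<close> over \<open>S\<close>
    for all \<open>p\<close>: a nontrivial relation with coefficient 1 at \<open>a\<close>.\<close>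
  obtain g where g: "g \<in> fun_vs.span B" "\<And>t. t \<in> S \<Longrightarrow> g t = 0" "g a \<noteq> 0"
  proof (rule ccontr)
    assume "\<not> thesis"
    with that have *: "g a = 0" if "g \<in> fun_vs.span B" "\<And>t. t \<in> S \<Longrightarrow> g t = 0" for g
      using that by blast
    have "\<forall>y\<in>insert a S. (\<lambda>y. if y = a then 1 else - l y a) y = 0"
    proof (rule insert.prems)
      fix p assume p: "p \<in> fun_vs.span B"
      define g where "g = (\<lambda>x. p x - (\<Sum>s\<in>S. p s * l s x))"
      have "(\<lambda>x. \<Sum>s\<in>S. p s * l s x) \<in> fun_vs.span B"
        using l by (intro fun_span_sum fun_vs.span_scale)
      then have "g \<in> fun_vs.span B" unfolding g_def using p by (intro fun_span_diff)
      moreover have "g t = 0" if "t \<in> S" for t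
        using that insert.hyps by (simp add: g_def ld if_distrib cong: if_cong)
      ultimately have "g a = 0" by (rule *)
      moreover have "(\<Sum>y\<in>S. (if y = a then 1 else - l y a) * p y) = (\<Sum>y\<in>S. - (p y * l y a))"
        using insert.hyps by (intro sum.cong) auto
      ultimately show "(\<Sum>y\<in>insert a S. (if y = a then 1 else - l y a) * p y) = 0"
        using insert.hyps by (simp add: g_def sum_negf)
    qed
    then show False by auto
  qed
  \<comment> \<open>\<open>g\<close> is normalised at \<open>a\<close>, and the old functions are
    corrected by multiples of \<open>g\<close> so as to vanish at \<open>a\<close>; their values on
    \<open>S\<close> do not change.\<close>
  define l' where "l' = (\<lambda>s x. if s = a then (1 / g a) * g x else l s x - (l s a / g a) * g x)"
  have la: "l' a = (\<lambda>x. (1 / g a) * g x)" by (simp add: l'_def)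
  have ls: "l' s = (\<lambda>x. l s x - (l s a / g a) * g x)" if "s \<in> S" for s
    using that insert.hyps by (auto simp: l'_def)
  have "l' s \<in> fun_vs.span B" if "s \<in> insert a S" for s
    using that g(1) l la ls by (auto intro!: fun_span_diff fun_vs.span_scale simp del: times_divide_eq_left)
  moreover have "l' s t = (if s = t then 1 else 0)" if "s \<in> insert a S" "t \<in> insert a S" for s t
    using that g(2,3) ld insert.hyps by (auto simp: l'_def)
  ultimately show ?case by blast
qed auto

text \<open>If every polynomial of degree \<open>m + 1\<close> vanishing on \<open>S\<close> vanished at \<open>a\<close>, then so would
  \<open>(1 - s \<bullet> x) * l s x\<close>, hence each \<open>l s\<close>, contradicting \<open>1 - (\<Sum>s\<in>S. l s) = 0\<close> at \<open>a\<close>.\<close>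

lemma separating_polynomial:
  fixes S :: "(real ^ 'd::finite) set"
  assumes S: "finite S" "S \<subseteq> sphere 0 1" and a: "a \<in> sphere 0 1" "a \<notin> S"
    and l: "\<And>s. s \<in> S \<Longrightarrow> l s \<in> poly_funs m"
    and ld: "\<And>s t. s \<in> S \<Longrightarrow> t \<in> S \<Longrightarrow> l s t = (if s = t then 1 else 0)"
  shows "\<exists>g\<in>poly_funs (Suc m). (\<forall>s\<in>S. g s = 0) \<and> g a \<noteq> 0"
proof (rule ccontr)
  assume "\<not> ?thesis"
  then have *: "g a = 0" if "g \<in> poly_funs (Suc m)" "\<And>s. s \<in> S \<Longrightarrow> g s = 0" for g
    using that by blast
  have "l s a = 0" if "s \<in> S" for s
  proof -
    have s: "s \<in> sphere 0 1" "s \<noteq> a" using S(2) that a by auto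
    have "(\<lambda>x. 1 - s \<bullet> x) \<in> poly_funs 1"
      by (intro poly_funs_diff poly_funs_const poly_funs_inner)
    then have "(\<lambda>x. (1 - s \<bullet> x) * l s x) \<in> poly_funs (Suc m)"
      using poly_funs_mult[OF _ l[OF that]] by fastforce
    moreover have "(1 - s \<bullet> t) * l s t = 0" if "t \<in> S" for t
      using ld[OF \<open>s \<in> S\<close> that] s(1) by (auto simp: norm_eq_1)
    ultimately have "(1 - s \<bullet> a) * l s a = 0" by (rule *)
    then show ?thesis using inner_sphere_bounds(2)[OF s(1) a(1) s(2)] by simp
  qed
  moreover have "(\<lambda>x. 1 - (\<Sum>s\<in>S. l s x)) \<in> poly_funs (Suc m)"
    using l poly_funs_mono[of m "Suc m"] by (intro poly_funs_diff poly_funs_const poly_funs_sum) auto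
  moreover have "1 - (\<Sum>s\<in>S. l s t) = 0" if "t \<in> S" for t
    using that S(1) by (simp add: ld)
  ultimately show False using *[of "\<lambda>x. 1 - (\<Sum>s\<in>S. l s x)"] by simp
qed

section \<open>Angular and Euclidean separation\<close>

text \<open>Jordan's inequality: the concave sine lies above its chord over the interval.\<close>

lemma sin_ge_linear:
  assumes "0 \<le> u" "u \<le> pi / 2"
  shows "2 * u / pi \<le> sin u"
proof -
  have "concave_on {0..pi / 2} sin"
    by (rule f''_le0_imp_concave[where f' = cos and f'' = "\<lambda>x. - sin x"])
      (auto intro!: derivative_eq_intros sin_ge_zero)
  from concave_onD_Icc'[OF this, of u] assms show ?thesis
    by (simp add: field_simps)
qed

text \<open>The chord of an angle \<theta> has length 2 sin(\<theta> / 2), to which Jordan's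
  inequality applies.\<close>

lemma dist_sphere_ge_angle:
  fixes x y :: "'a::real_inner"
  assumes "x \<in> sphere 0 1" "y \<in> sphere 0 1"
  shows "2 * arccos (x \<bullet> y) / pi \<le> dist x y"
proof -
  define \<theta> where "\<theta> = arccos (x \<bullet> y)"
  have "\<bar>x \<bullet> y\<bar> \<le> 1" using Cauchy_Schwarz_ineq2[of x y] assms by simp
  then have \<theta>: "0 \<le> \<theta>" "\<theta> \<le> pi" "cos \<theta> = x \<bullet> y"
    unfolding \<theta>_def by (auto simp: arccos_lbound arccos_ubound cos_arccos_abs)
  have sq: "dist x y ^ 2 = (2 * sin (\<theta> / 2)) ^ 2"
    using dist_sphere[OF assms] cos_double_sin[of "\<theta> / 2"] \<theta>(3) by (simp add: power_mult_distrib)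
  have "0 \<le> 2 * sin (\<theta> / 2)" using \<theta> by (simp add: sin_ge_zero)
  with sq have "dist x y = 2 * sin (\<theta> / 2)" by (rule power2_eq_imp_eq[OF _ zero_le_dist])
  moreover have "2 * (\<theta> / 2) / pi \<le> sin (\<theta> / 2)" using \<theta> by (intro sin_ge_linear) auto
  ultimately show ?thesis by (simp add: \<theta>_def)
qed

lemma sep_le_arccos:
  assumes "finite \<Omega>" "a \<in> \<Omega>" "b \<in> \<Omega>" "a \<noteq> b"
  shows "sep \<Omega> \<le> arccos (a \<bullet> b)"
  unfolding sep_def
proof (rule Min_le)
  have "{arccos (a \<bullet> b) | a b. a \<in> \<Omega> \<and> b \<in> \<Omega> \<and> a \<noteq> b} \<subseteq> (\<lambda>(a, b). arccos (a \<bullet> b)) ` (\<Omega> \<times> \<Omega>)"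
    by auto
  then show "finite {arccos (a \<bullet> b) | a b. a \<in> \<Omega> \<and> b \<in> \<Omega> \<and> a \<noteq> b}"
    by (rule finite_subset) (use assms(1) in auto)
qed (use assms in blast)

section \<open>Expansion in spherical harmonics\<close>

lemma finite_harm_index [simp]: "finite (harm_index d n)"
  by (simp add: harm_index_def)

lemma fun_of_coeffs_eq:
  fixes Y :: "nat \<Rightarrow> nat \<Rightarrow> real ^ 'd::finite \<Rightarrow> real"
  shows "fun_of_coeffs Y n c a = (\<Sum>\<gamma>\<in>harm_index TYPE('d) n. c \<gamma> * Y (fst \<gamma>) (snd \<gamma>) a)"
  by (simp add: fun_of_coeffs_def case_prod_beta)

text \<open>Each monomial is decomposed harmonically, and each space of harmonics is spanned by its
  part of \<open>Y\<close>. The coefficients are extensional, as vectors in \<open>mat_ker\<close>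
  are.\<close>

lemma poly_funs_expansion:
  fixes Y :: "nat \<Rightarrow> nat \<Rightarrow> real ^ 'd::finite \<Rightarrow> real"
  assumes Y: "orthonormal_harmonic_basis Y" and p: "p \<in> poly_funs n"
  shows "\<exists>c\<in>harm_index TYPE('d) n \<rightarrow>\<^sub>E UNIV. fun_of_coeffs Y n c = sphere_restrict p"
proof -
  let ?J = "harm_index TYPE('d) n"
  let ?H = "\<Union>i\<le>n. spherical_harmonics i :: (real ^ 'd \<Rightarrow> real) set"
  let ?B = "\<Union>k\<le>n. Y k ` {1..harm_dim TYPE('d) k}"
  have "sphere_restrict p \<in> fun_vs.span ?H"
    using p unfolding poly_funs_def
  proof (rule fun_span_image)
    fix f :: "real ^ 'd \<Rightarrow> real"
    assume "f \<in> monomial ` {\<alpha>. sum \<alpha> UNIV \<le> n}"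
    then obtain k where "k \<le> n" "f \<in> homogeneous_polys k"
      using monomial_in_homogeneous by blast
    then have "sphere_restrict f \<in> fun_vs.span (\<Union>i\<le>k. spherical_harmonics i)"
      by (intro homogeneous_harmonic_decomposition)
    also have "\<dots> \<subseteq> fun_vs.span ?H"
      using \<open>k \<le> n\<close> by (intro fun_vs.span_mono UN_mono) auto
    finally show "sphere_restrict f \<in> fun_vs.span ?H" .
  qed (simp_all add: sphere_restrict_add sphere_restrict_scale sphere_restrict_zero)
  also have "fun_vs.span ?H \<subseteq> fun_vs.span ?B"
  proof (intro fun_vs.span_minimal UN_least)
    fix k assume "k \<in> {..n}"
    then have "fun_vs.span (Y k ` {1..harm_dim TYPE('d) k}) \<subseteq> fun_vs.span ?B"
      by (intro fun_vs.span_mono) auto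
    then show "spherical_harmonics k \<subseteq> fun_vs.span ?B"
      using Y by (simp add: orthonormal_harmonic_basis_def)
  qed (rule fun_vs.subspace_span)
  finally have "\<exists>c. fun_of_coeffs Y n c = sphere_restrict p"
  proof (induction rule: fun_span_induct)
    case (base f)
    then obtain \<gamma> where \<gamma>: "\<gamma> \<in> ?J" "f = Y (fst \<gamma>) (snd \<gamma>)" by (auto simp: harm_index_def)
    then have "fun_of_coeffs Y n (\<lambda>\<beta>. if \<beta> = \<gamma> then 1 else 0) = f"
      by (simp add: fun_of_coeffs_eq fun_eq_iff if_distrib[of "\<lambda>c. c * _"] cong: if_cong)
    then show ?case by blast
  next
    case zero
    have "fun_of_coeffs Y n (\<lambda>_. 0) = (\<lambda>x. 0)" by (simp add: fun_of_coeffs_eq fun_eq_iff)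
    then show ?case by blast
  next
    case (add f g)
    then obtain c c' where "fun_of_coeffs Y n c = f" "fun_of_coeffs Y n c' = g" by blast
    then have "fun_of_coeffs Y n (\<lambda>\<gamma>. c \<gamma> + c' \<gamma>) = (\<lambda>x. f x + g x)"
      by (auto simp: fun_of_coeffs_eq fun_eq_iff distrib_right sum.distrib)
    then show ?case by blast
  next
    case (scale b f)
    then obtain c where "fun_of_coeffs Y n c = f" by blast
    then have "fun_of_coeffs Y n (\<lambda>\<gamma>. b * c \<gamma>) = (\<lambda>x. b * f x)"
      by (auto simp: fun_of_coeffs_eq fun_eq_iff mult.assoc simp flip: sum_distrib_left)
    then show ?case by blast
  qed
  then obtain c where "fun_of_coeffs Y n c = sphere_restrict p" ..
  moreover have "fun_of_coeffs Y n (restrict c ?J) = fun_of_coeffs Y n c"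
    by (simp add: fun_of_coeffs_eq fun_eq_iff)
  ultimately show ?thesis by (intro bexI[of _ "restrict c ?J"]) auto
qed

lemma harmonic_eq_restrict_poly:
  fixes Y :: "nat \<Rightarrow> nat \<Rightarrow> real ^ 'd::finite \<Rightarrow> real"
  assumes "orthonormal_harmonic_basis Y" "(k, l) \<in> harm_index TYPE('d) n"
  shows "\<exists>p\<in>poly_funs n. Y k l = sphere_restrict p"
proof -
  have kl: "k \<le> n" "l \<in> {1..harm_dim TYPE('d) k}" using assms(2) by (auto simp: harm_index_def)
  then have "Y k l \<in> fun_vs.span (Y k ` {1..harm_dim TYPE('d) k})"
    by (intro fun_vs.span_base) auto
  also have "\<dots> = spherical_harmonics k"
    using assms(1) by (simp add: orthonormal_harmonic_basis_def)
  finally obtain p where "p \<in> homogeneous_polys k" "Y k l = sphere_restrict p"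
    by (auto simp: spherical_harmonics_def)
  moreover have "homogeneous_polys k \<subseteq> poly_funs n"
    using homogeneous_subset_poly_funs poly_funs_mono[OF kl(1)] by blast
  ultimately show ?thesis by blast
qed

text \<open>A product of two polynomials of degree at most \<open>n\<close> has degree at most
  \<open>2 * n\<close>; this is why moments up to that degree suffice.\<close>

lemma harmonic_mult_expansion:
  fixes Y :: "nat \<Rightarrow> nat \<Rightarrow> real ^ 'd::finite \<Rightarrow> real"
  assumes Y: "orthonormal_harmonic_basis Y"
    and "(k, l) \<in> harm_index TYPE('d) n" "(k', l') \<in> harm_index TYPE('d) n"
  shows "\<exists>c. \<forall>a. Y k l a * Y k' l' a = fun_of_coeffs Y (2 * n) c a"
proof -
  obtain p p' where p: "p \<in> poly_funs n" "Y k l = sphere_restrict p"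
    and p': "p' \<in> poly_funs n" "Y k' l' = sphere_restrict p'"
    using harmonic_eq_restrict_poly assms by meson
  have "(\<lambda>x. p x * p' x) \<in> poly_funs (2 * n)"
    using poly_funs_mult[OF p(1) p'(1)] by (simp add: mult_2)
  from poly_funs_expansion[OF Y this] obtain c
    where "fun_of_coeffs Y (2 * n) c = sphere_restrict (\<lambda>x. p x * p' x)" by blast
  then have "Y k l a * Y k' l' a = fun_of_coeffs Y (2 * n) c a" for a
    by (simp add: p(2) p'(2) sphere_restrict_def)
  then show ?thesis by blast
qed

section \<open>Entries and kernel of the matrix\<close>

lemma H_tilde_eq:
  "H_tilde Y M fh x \<alpha> \<beta> =
    (\<Sum>j=1..M. fh j * (Y (fst \<alpha>) (snd \<alpha>) (x j) * Y (fst \<beta>) (snd \<beta>) (x j)))"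
proof -
  have "(\<Sum>i=1..M. fourier_matrix Y x i \<alpha> * mat_diag fh i j) = fourier_matrix Y x j \<alpha> * fh j"
    if "j \<in> {1..M}" for j
    using that by (simp add: mat_diag_def if_distrib[of "\<lambda>c. _ * c"] cong: if_cong)
  then show ?thesis
    by (simp add: H_tilde_def mat_mult_def mat_transpose_def fourier_matrix_def case_prod_beta mult_ac)
qed

text \<open>An entry is a weighted sum over the nodes of a product of two harmonics. Expanding the
  product and swapping the sums leaves moments, with coefficients \<open>c\<close> that do not
  involve the nodes or weights.\<close>

lemma H_tilde_moments:
  fixes Y :: "nat \<Rightarrow> nat \<Rightarrow> real ^ 'd::finite \<Rightarrow> real"
  assumes "\<And>a. Y (fst \<alpha>) (snd \<alpha>) a * Y (fst \<beta>) (snd \<beta>) a = fun_of_coeffs Y m c a"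
  shows "H_tilde Y M fh x \<alpha> \<beta> =
    (\<Sum>\<gamma>\<in>harm_index TYPE('d) m. c \<gamma> * restrict (moments Y M fh x) (harm_index TYPE('d) m) \<gamma>)"
proof -
  have "H_tilde Y M fh x \<alpha> \<beta> =
      (\<Sum>j=1..M. \<Sum>\<gamma>\<in>harm_index TYPE('d) m. c \<gamma> * (fh j * Y (fst \<gamma>) (snd \<gamma>) (x j)))"
    by (simp add: H_tilde_eq assms fun_of_coeffs_eq sum_distrib_left mult_ac)
  also have "\<dots> = (\<Sum>\<gamma>\<in>harm_index TYPE('d) m. c \<gamma> * (\<Sum>j=1..M. fh j * Y (fst \<gamma>) (snd \<gamma>) (x j)))"
    by (subst sum.swap) (simp add: sum_distrib_left)
  finally show ?thesis by (simp add: moments_def case_prod_beta)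
qed

lemma H_tilde_mult_vec:
  fixes Y :: "nat \<Rightarrow> nat \<Rightarrow> real ^ 'd::finite \<Rightarrow> real"
  shows "(\<Sum>\<beta>\<in>harm_index TYPE('d) n. H_tilde Y M fh x \<alpha> \<beta> * c \<beta>) =
    (\<Sum>j=1..M. fh j * fun_of_coeffs Y n c (x j) * Y (fst \<alpha>) (snd \<alpha>) (x j))"
proof -
  have "(\<Sum>\<beta>\<in>harm_index TYPE('d) n. H_tilde Y M fh x \<alpha> \<beta> * c \<beta>) =
    (\<Sum>j=1..M. \<Sum>\<beta>\<in>harm_index TYPE('d) n.
      fh j * (c \<beta> * Y (fst \<beta>) (snd \<beta>) (x j)) * Y (fst \<alpha>) (snd \<alpha>) (x j))"
    by (simp add: H_tilde_eq sum_distrib_right) (subst sum.swap, simp add: mult_ac)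
  then show ?thesis
    by (simp add: fun_of_coeffs_eq sum_distrib_left sum_distrib_right)
qed

text \<open>In the factorisation Y^T D Y the map Y^T is injective because the evaluations are
  independent, and D is injective because the weights are nonzero. Hence only the kernel of Y
  remains.\<close>

lemma mat_ker_H_tilde:
  fixes Y :: "nat \<Rightarrow> nat \<Rightarrow> real ^ 'd::finite \<Rightarrow> real"
  assumes Y: "orthonormal_harmonic_basis Y"
    and x: "x ` {1..M} \<subseteq> sphere 0 1" "inj_on x {1..M}" and fh: "\<forall>j\<in>{1..M}. fh j \<noteq> 0"
    and indep: "\<And>c. (\<And>p. p \<in> poly_funs n \<Longrightarrow> (\<Sum>y\<in>x ` {1..M}. c y * p y) = 0) \<Longrightarrow> \<forall>y\<in>x ` {1..M}. c y = 0"
  shows "mat_ker (harm_index TYPE('d) n) (harm_index TYPE('d) n) (H_tilde Y M fh x) =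
    {c \<in> harm_index TYPE('d) n \<rightarrow>\<^sub>E UNIV. \<forall>j\<in>{1..M}. fun_of_coeffs Y n c (x j) = 0}"
proof -
  let ?J = "harm_index TYPE('d) n"
  have "fun_of_coeffs Y n c (x j) = 0"
    if ker: "\<forall>\<alpha>\<in>?J. (\<Sum>\<beta>\<in>?J. H_tilde Y M fh x \<alpha> \<beta> * c \<beta>) = 0" and j: "j \<in> {1..M}" for c j
  proof -
    define b where "b = (\<lambda>j. fh j * fun_of_coeffs Y n c (x j))"
    have b: "(\<Sum>j=1..M. b j * Y (fst \<alpha>) (snd \<alpha>) (x j)) = 0" if "\<alpha> \<in> ?J" for \<alpha>
      using ker that by (simp add: b_def H_tilde_mult_vec)
    \<comment> \<open>Independence concerns coefficients attached to points, so the index of a point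
      is recovered by inverting \<open>x\<close>.\<close>
    have "\<forall>y\<in>x ` {1..M}. b (the_inv_into {1..M} x y) = 0"
    proof (rule indep)
      fix p :: "real ^ 'd \<Rightarrow> real"
      assume "p \<in> poly_funs n"
      from poly_funs_expansion[OF Y this] obtain c' where c': "fun_of_coeffs Y n c' = sphere_restrict p"
        by blast
      have "p (x j) = (\<Sum>\<alpha>\<in>?J. c' \<alpha> * Y (fst \<alpha>) (snd \<alpha>) (x j))" if "j \<in> {1..M}" for j
      proof -
        have "x j \<in> sphere 0 1" using that x(1) by blast
        then show ?thesis
          using fun_cong[OF c', of "x j"] by (simp add: sphere_restrict_def fun_of_coeffs_eq)
      qed
      then have "(\<Sum>j=1..M. b j * p (x j)) = (\<Sum>j=1..M. \<Sum>\<alpha>\<in>?J. c' \<alpha> * (b j * Y (fst \<alpha>) (snd \<alpha>) (x j)))"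
        by (simp add: sum_distrib_left mult_ac)
      also have "\<dots> = (\<Sum>\<alpha>\<in>?J. c' \<alpha> * (\<Sum>j=1..M. b j * Y (fst \<alpha>) (snd \<alpha>) (x j)))"
        by (subst sum.swap) (simp add: sum_distrib_left)
      also have "\<dots> = 0" using b by simp
      finally show "(\<Sum>y\<in>x ` {1..M}. b (the_inv_into {1..M} x y) * p y) = 0"
        using x(2) by (simp add: sum.reindex the_inv_into_f_f)
    qed
    then have "b j = 0" using j x(2) by (auto simp: the_inv_into_f_f)
    then show ?thesis using fh j by (simp add: b_def)
  qed
  then show ?thesis
    by (auto simp: mat_ker_def H_tilde_mult_vec)
qed

section \<open>Recovering the nodes from the kernel and the entries from the moments\<close>

theorem theorem3p14:
  fixes Y :: "nat \<Rightarrow> nat \<Rightarrow> real ^ 'd::finite \<Rightarrow> real"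
    and n :: nat
  assumes "CARD('d) \<ge> 2"
    and "orthonormal_harmonic_basis Y"
  shows "\<exists>G :: (nat \<times> nat \<Rightarrow> real) \<Rightarrow> nat \<times> nat \<Rightarrow> nat \<times> nat \<Rightarrow> real.
    \<forall>(M::nat) (x :: nat \<Rightarrow> real ^ 'd) (fh :: nat \<Rightarrow> real) (q::real).
      M \<ge> 1 \<longrightarrow> x ` {1..M} \<subseteq> sphere 0 1 \<longrightarrow> inj_on x {1..M} \<longrightarrow>
      (\<forall>j\<in>{1..M}. fh j \<noteq> 0) \<longrightarrow>
      q > 0 \<longrightarrow> (M \<ge> 2 \<longrightarrow> sep (x ` {1..M}) > q) \<longrightarrow>
      real n > 2.5 * pi * real CARD('d) / q + 1 \<longrightarrow>
        x ` {1..M} =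
          sphere_zeros (fun_of_coeffs Y n `
            mat_ker (harm_index TYPE('d) n) (harm_index TYPE('d) n) (H_tilde Y M fh x)) \<and>
        (\<forall>\<alpha>\<in>harm_index TYPE('d) n. \<forall>\<beta>\<in>harm_index TYPE('d) n.
          H_tilde Y M fh x \<alpha> \<beta> = G (restrict (moments Y M fh x) (harm_index TYPE('d) (2 * n))) \<alpha> \<beta>)"
proof -
  let ?J = "harm_index TYPE('d)"
  \<comment> \<open>The coefficients are chosen before \<open>M\<close>, \<open>x\<close>,
    \<open>fh\<close> and \<open>q\<close> are fixed, so the function built from them depends on
    \<open>Y\<close> and \<open>n\<close> only.\<close>
  define C where "C = (\<lambda>\<alpha> \<beta>. SOME c. \<forall>a. Y (fst \<alpha>) (snd \<alpha>) a * Y (fst \<beta>) (snd \<beta>) a = fun_of_coeffs Y (2 * n) c a)"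
  have C: "Y (fst \<alpha>) (snd \<alpha>) a * Y (fst \<beta>) (snd \<beta>) a = fun_of_coeffs Y (2 * n) (C \<alpha> \<beta>) a"
    if "\<alpha> \<in> ?J n" "\<beta> \<in> ?J n" for \<alpha> \<beta> a
  proof -
    have "\<exists>c. \<forall>a. Y (fst \<alpha>) (snd \<alpha>) a * Y (fst \<beta>) (snd \<beta>) a = fun_of_coeffs Y (2 * n) c a"
      using that by (intro harmonic_mult_expansion[OF assms(2)]) auto
    from someI_ex[OF this] show ?thesis unfolding C_def by blast
  qed
  have zeros: "x ` {1..M} = sphere_zeros (fun_of_coeffs Y n ` mat_ker (?J n) (?J n) (H_tilde Y M fh x))"
    if x: "x ` {1..M} \<subseteq> sphere 0 1" "inj_on x {1..M}" and fh: "\<forall>j\<in>{1..M}. fh j \<noteq> 0"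
      and "q > 0" and q: "M \<ge> 2 \<Longrightarrow> sep (x ` {1..M}) > q"
      and n: "real n > 2.5 * pi * real CARD('d) / q + 1"
    for M x fh q
  proof -
    let ?\<Omega> = "x ` {1..M}"
    \<comment> \<open>One degree is kept back for the linear factor of the separating polynomial.
      \<open>N\<close> is the largest order whose Fejer power has degree at most \<open>m\<close>,
      and \<open>\<delta>\<close> bounds the chords from below when the angles exceed
      \<open>q\<close>.\<close>
    define m N \<delta> where "m = n - 1" and "N = m div CARD('d) + 1" and "\<delta> = 2 * q / pi"
    have "\<delta> > 0" using \<open>q > 0\<close> by (simp add: \<delta>_def)
    have "0 < 2.5 * pi * real CARD('d) / q" using \<open>q > 0\<close> by simp
    then have "n \<ge> 1" using n by linarith
    have "m < N * CARD('d)"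
      using dividend_less_times_div[of "CARD('d)" m] by (simp add: N_def algebra_simps)
    then have "real m < real N * real CARD('d)"
      by (metis of_nat_less_iff of_nat_mult)
    moreover have "real m = real n - 1" using \<open>n \<ge> 1\<close> by (simp add: m_def of_nat_diff)
    \<comment> \<open>Cancelling the dimension and multiplying by \<open>\<delta>\<close> turns the
      condition on \<open>n\<close> into \<open>5 < N * \<delta>\<close>.\<close>
    ultimately have "2.5 * pi * real CARD('d) / q < real N * real CARD('d)"
      using n by linarith
    then have "(2.5 * pi / q) * real CARD('d) < real N * real CARD('d)"
      by simp
    then have "2.5 * pi / q < real N"
      by (rule mult_right_less_imp_less) simp
    then have "(2.5 * pi / q) * \<delta> < real N * \<delta>"
      using \<open>\<delta> > 0\<close> by (rule mult_strict_right_mono)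
    moreover have "(2.5 * pi / q) * \<delta> = 5" using \<open>q > 0\<close> by (simp add: \<delta>_def)
    ultimately have "5 \<le> real N * \<delta>" by linarith
    moreover have "CARD('d) * (N - 1) \<le> m" by (simp add: N_def)
    moreover have "\<delta> \<le> dist y z" if "y \<in> ?\<Omega>" "z \<in> ?\<Omega>" "y \<noteq> z" for y z
    proof -
      \<comment> \<open>Two distinct nodes exist here, so the separation hypothesis applies and
        \<open>sep\<close> is a minimum over a nonempty set.\<close>
      have "M \<ge> 2"
      proof (rule ccontr)
        assume "\<not> M \<ge> 2"
        then have "{1..M} \<subseteq> {1}" by auto
        with that show False by auto
      qed
      then have "q \<le> arccos (y \<bullet> z)"
        using q sep_le_arccos[of ?\<Omega> y z] that by fastforce
      then have "\<delta> \<le> 2 * arccos (y \<bullet> z) / pi"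
        by (simp add: \<delta>_def divide_right_mono)
      also have "\<dots> \<le> dist y z" using that x(1) by (intro dist_sphere_ge_angle) auto
      finally show ?thesis .
    qed
    ultimately have indep: "\<forall>y\<in>?\<Omega>. c y = 0"
      if "\<And>p. p \<in> poly_funs m \<Longrightarrow> (\<Sum>y\<in>?\<Omega>. c y * p y) = 0" for c
      using evaluations_independent[OF assms(1) _ x(1) \<open>\<delta> > 0\<close>] that by auto
    have "\<exists>l. \<forall>s\<in>?\<Omega>. l s \<in> poly_funs m \<and> (\<forall>t\<in>?\<Omega>. l s t = (if s = t then 1 else 0))"
      unfolding poly_funs_def
    proof (rule lagrange_functions)
      fix c :: "real ^ 'd \<Rightarrow> real"
      assume "\<And>p. p \<in> fun_vs.span (monomial ` {\<alpha>. sum \<alpha> UNIV \<le> m}) \<Longrightarrow> (\<Sum>y\<in>?\<Omega>. c y * p y) = 0"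
      then show "\<forall>y\<in>?\<Omega>. c y = 0" by (intro indep) (simp only: poly_funs_def)
    qed simp
    then obtain l where l: "\<And>s. s \<in> ?\<Omega> \<Longrightarrow> l s \<in> poly_funs m"
      and ld: "\<And>s t. s \<in> ?\<Omega> \<Longrightarrow> t \<in> ?\<Omega> \<Longrightarrow> l s t = (if s = t then 1 else 0)"
      by blast
    have ker: "mat_ker (?J n) (?J n) (H_tilde Y M fh x) =
        {c \<in> ?J n \<rightarrow>\<^sub>E UNIV. \<forall>j\<in>{1..M}. fun_of_coeffs Y n c (x j) = 0}"
    proof (rule mat_ker_H_tilde[OF assms(2) x fh])
      fix c :: "real ^ 'd \<Rightarrow> real"
      assume "\<And>p. p \<in> poly_funs n \<Longrightarrow> (\<Sum>y\<in>?\<Omega>. c y * p y) = 0"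
      then show "\<forall>y\<in>?\<Omega>. c y = 0"
        \<comment> \<open>A relation that holds in degree \<open>n\<close> holds in particular in
          degree \<open>m\<close>.\<close>
        using poly_funs_mono[of m n] by (intro indep) (auto simp: m_def)
    qed
    have "\<exists>g\<in>fun_of_coeffs Y n ` mat_ker (?J n) (?J n) (H_tilde Y M fh x). g a \<noteq> 0"
      if a: "a \<in> sphere 0 1" "a \<notin> ?\<Omega>" for a
    proof -
      obtain g where g: "g \<in> poly_funs (Suc m)" "\<And>s. s \<in> ?\<Omega> \<Longrightarrow> g s = 0" "g a \<noteq> 0"
        using separating_polynomial[OF _ x(1) a l ld] by auto
      have "Suc m = n" using \<open>n \<ge> 1\<close> by (simp add: m_def)
      with poly_funs_expansion[OF assms(2)] g(1) obtain c
        where c: "c \<in> ?J n \<rightarrow>\<^sub>E UNIV" "fun_of_coeffs Y n c = sphere_restrict g" by blast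
      have "fun_of_coeffs Y n c (x j) = 0" if "j \<in> {1..M}" for j
        using g(2)[of "x j"] that by (simp add: c sphere_restrict_def)
      then have "c \<in> mat_ker (?J n) (?J n) (H_tilde Y M fh x)"
        unfolding ker using c(1) by simp
      moreover have "fun_of_coeffs Y n c a \<noteq> 0" using g(3) a by (simp add: c sphere_restrict_def)
      ultimately show ?thesis by blast
    qed
    then have "sphere_zeros (fun_of_coeffs Y n ` mat_ker (?J n) (?J n) (H_tilde Y M fh x)) \<subseteq> ?\<Omega>"
      unfolding sphere_zeros_def by blast
    moreover have "?\<Omega> \<subseteq> sphere_zeros (fun_of_coeffs Y n ` mat_ker (?J n) (?J n) (H_tilde Y M fh x))"
      using x(1) by (auto simp: sphere_zeros_def ker)
    ultimately show ?thesis by blast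
  qed
  show ?thesis
    \<comment> \<open>Each entry is a linear form in the moments, with coefficient vector
      \<open>C \<alpha> \<beta>\<close>.\<close>
    by (intro exI[of _ "\<lambda>m \<alpha> \<beta>. \<Sum>\<gamma>\<in>?J (2 * n). C \<alpha> \<beta> \<gamma> * m \<gamma>"] allI impI conjI ballI zeros
        H_tilde_moments C) auto
qed

end
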